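(* Let $d\ge2$ and let $T$ be a Gaussian isotropic random field on $\mathbb S^{d-1}$ with angular power spectrum $(A_\ell,\ell\in\mathbb N_0)$ that decays algebraically with order $\alpha>2$; that is, there exist constants $C>0$ and $\ell_0\in\mathbb N$ such that $A_\ell\le C\cdot\ell^{-\alpha}$ for all $\ell>\ell_0$. Then the series of approximate random fields $(T^\kappa,\kappa\in\mathbb N)$ converges to the random field $T$ in $L^p(\Omega;L^2(\mathbb S^{d-1}))$ for any finite $p\ge1$, and the truncation error is bounded by $$\|T-T^\kappa\|_{L^p(\Omega;L^2(\mathbb S^{d-1}))}\le C_p\cdot\kappa^{-(\alpha+1-d)/2}$$ for $\kappa\ge\ell_0$, where $C_p>0$ is a constant that depends on $d$, $p$ and $\alpha$. Furthermore the series of approximate random fields $(T^\kappa,\kappa\in\mathbb N)$ converges to the random field $T$ $\mathbb P$-almost surely, and for all $\beta<(\alpha+1-d)/2$ the truncation error is asymptotically (in $\kappa$) bounded by $$\|T-T^\kappa\|_{L^2(\mathbb S^{d-1})}\le\kappa^{-\beta},\qquad\mathbb P\text{-a.s.}$$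
   Context: $\mathbb S^{d-1}$ is the unit sphere in $\mathbb R^d$. A Gaussian isotropic random field on $\mathbb S^{d-1}$ is a jointly measurable, square-integrable Gaussian field $T:\Omega\times\mathbb S^{d-1}\to\mathbb R$ with constant mean, taken to be $0$ without loss of generality, whose covariance $\mathbb E(T(x)T(y))$ depends only on the geodesic distance of $x$ and $y$. Let $(S_{\ell m},\ \ell\in\mathbb N_0,\ m=1,\dots,h(\ell,d))$ be the real orthonormal spherical harmonics on $\mathbb S^{d-1}$, with $h(\ell,d)=(2\ell+d-2)\frac{(\ell+d-3)!}{(d-2)!\,\ell!}$ (and $h(0,2)=1$). Then $T$ has the Karhunen–Loève expansion $T=\sum_{\ell=0}^\infty\sum_{m=1}^{h(\ell,d)}a_{\ell m}S_{\ell m}$ with independent centered Gaussian $a_{\ell m}$ satisfying $\mathbb E(a_{\ell m}a_{\ell'm'})=A_\ell\delta_{\ell\ell'}\delta_{mm'}$; the sequence $(A_\ell)$ of nonnegative reals is the angular power spectrum and satisfies $\sum_\ell A_\ell h(\ell,d)<\infty$. The approximate (truncated) field is $T^\kappa=\sum_{\ell=0}^\kappa\sum_{m=1}^{h(\ell,d)}a_{\ell m}S_{\ell m}$.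
   Formalization: C_p cannot depend on d, p, α alone (scale T): for α>d−1 it is K·√C with K depending only on d, p, α; for 2<α≤d−1 no constant uniform over spectra with A_ℓ≤Cℓ^{-α} exists (truncate the spectrum at large N), and C_p may depend on T, but not on κ. *)

theory Defs
  imports "HOL-Probability.Probability"
begin

text \<open>The Euclidean space \<open>\<real>\<^sup>d\<close> is a type \<open>'a::euclidean_space\<close> with \<open>d = DIM('a)\<close>, and
  the unit sphere is \<open>sphere 0 1 :: 'a set\<close>. Functions on the sphere are functions on \<open>'a\<close>
  whose values outside the sphere are irrelevant.\<close>

definition geodesic_dist :: "'a::euclidean_space \<Rightarrow> 'a \<Rightarrow> real" where
  "geodesic_dist x y = arccos (x \<bullet> y)"

text \<open>In polar coordinates the cone \<open>{r x | 0 < r < 1, x \<in> B}\<close> over a Borel subset \<open>B\<close> of the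
  sphere has Lebesgue measure \<open>\<sigma>(B) / d\<close>, where \<open>\<sigma>\<close> is the surface measure. Note that
  \<open>sgn x = x /\<^sub>R norm x\<close>.\<close>

definition surface_measure :: "'a::euclidean_space measure" where
  "surface_measure = scale_measure (of_nat DIM('a))
     (distr (restrict_space lborel (ball 0 1 - {0})) (restrict_space borel (sphere 0 1)) sgn)"

definition L2_sphere :: "('a::euclidean_space \<Rightarrow> real) \<Rightarrow> bool" where
  "L2_sphere f \<longleftrightarrow> f \<in> borel_measurable surface_measure \<and>
     integrable surface_measure (\<lambda>x. (f x)\<^sup>2)"

definition L2_sphere_norm :: "('a::euclidean_space \<Rightarrow> real) \<Rightarrow> real" where
  "L2_sphere_norm f = sqrt (\<integral>x. (f x)\<^sup>2 \<partial>surface_measure)"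

text \<open>The Bochner space \<open>L\<^sup>p(\<Omega>; L\<^sup>2(S))\<close> and its norm. As the Bochner integral of a non-integrable
  function is \<open>0\<close>, the norms are meaningful only for members of the respective spaces.\<close>

definition Lp_L2 :: "real \<Rightarrow> 'w measure \<Rightarrow> ('w \<Rightarrow> 'a::euclidean_space \<Rightarrow> real) \<Rightarrow> bool" where
  "Lp_L2 p M X \<longleftrightarrow>
     (\<lambda>(\<omega>, x). X \<omega> x) \<in> borel_measurable (M \<Otimes>\<^sub>M surface_measure) \<and>
     (AE \<omega> in M. L2_sphere (X \<omega>)) \<and>
     integrable M (\<lambda>\<omega>. L2_sphere_norm (X \<omega>) powr p)"

definition Lp_L2_norm :: "real \<Rightarrow> 'w measure \<Rightarrow> ('w \<Rightarrow> 'a::euclidean_space \<Rightarrow> real) \<Rightarrow> real" where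
  "Lp_L2_norm p M X = (\<integral>\<omega>. L2_sphere_norm (X \<omega>) powr p \<partial>M) powr (1 / p)"

definition laplacian :: "('a::euclidean_space \<Rightarrow> real) \<Rightarrow> 'a \<Rightarrow> real" where
  "laplacian P x = (\<Sum>b\<in>Basis. deriv (deriv (\<lambda>t. P (x + t *\<^sub>R b))) 0)"

definition spherical_harmonic :: "nat \<Rightarrow> ('a::euclidean_space \<Rightarrow> real) \<Rightarrow> bool" where
  "spherical_harmonic l f \<longleftrightarrow>
     (\<exists>P. real_polynomial_function P \<and> (\<forall>c x. P (c *\<^sub>R x) = c ^ l * P x) \<and>
          (\<forall>x. laplacian P x = 0) \<and> (\<forall>x\<in>sphere 0 1. f x = P x))"

text \<open>For \<open>d \<ge> 2\<close> the division is exact, and the subtraction truncates only if \<open>l = 0\<close> and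
  \<open>d = 2\<close>.\<close>

definition harmonic_dim :: "nat \<Rightarrow> nat \<Rightarrow> nat" where
  "harmonic_dim l d =
     (if l = 0 \<and> d = 2 then 1
      else (2 * l + d - 2) * fact (l + d - 3) div (fact (d - 2) * fact l))"

text \<open>The space of spherical harmonics of degree \<open>l\<close> has dimension \<open>harmonic_dim l d\<close>, so
  that the family below contains an orthonormal basis of it for every \<open>l\<close>.\<close>

definition orthonormal_harmonics :: "(nat \<Rightarrow> nat \<Rightarrow> 'a::euclidean_space \<Rightarrow> real) \<Rightarrow> bool" where
  "orthonormal_harmonics S \<longleftrightarrow>
     (\<forall>l. \<forall>m\<in>{1..harmonic_dim l DIM('a)}. spherical_harmonic l (S l m)) \<and>
     (\<forall>l l'. \<forall>m\<in>{1..harmonic_dim l DIM('a)}. \<forall>m'\<in>{1..harmonic_dim l' DIM('a)}.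
        (\<integral>x. S l m x * S l' m' x \<partial>surface_measure) = (if l = l' \<and> m = m' then 1 else 0))"

text \<open>Degenerate (constant) Gaussian variables are admitted.\<close>

definition gaussian_rv :: "'w measure \<Rightarrow> ('w \<Rightarrow> real) \<Rightarrow> bool" where
  "gaussian_rv M X \<longleftrightarrow> X \<in> borel_measurable M \<and>
     (\<exists>\<mu> s. distr M borel X = return borel \<mu> \<or>
            s > 0 \<and> distr M borel X = density lborel (\<lambda>y. ennreal (normal_density \<mu> s y)))"

definition gaussian_isotropic_field ::
    "'w measure \<Rightarrow> ('w \<Rightarrow> 'a::euclidean_space \<Rightarrow> real) \<Rightarrow> bool" where
  "gaussian_isotropic_field M T \<longleftrightarrow> prob_space M \<and>
     (\<lambda>(\<omega>, x). T \<omega> x) \<in> borel_measurable (M \<Otimes>\<^sub>M restrict_space borel (sphere 0 1)) \<and>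
     (\<forall>x\<in>sphere 0 1. integrable M (\<lambda>\<omega>. (T \<omega> x)\<^sup>2)) \<and>
     (\<forall>F c. finite F \<and> F \<subseteq> sphere 0 1 \<longrightarrow> gaussian_rv M (\<lambda>\<omega>. \<Sum>x\<in>F. c x * T \<omega> x)) \<and>
     (\<forall>x\<in>sphere 0 1. (\<integral>\<omega>. T \<omega> x \<partial>M) = 0) \<and>
     (\<exists>\<rho>. \<forall>x\<in>sphere 0 1. \<forall>y\<in>sphere 0 1.
        (\<integral>\<omega>. T \<omega> x * T \<omega> y \<partial>M) = \<rho> (geodesic_dist x y))"

definition truncated_field ::
    "(nat \<Rightarrow> nat \<Rightarrow> 'a::euclidean_space \<Rightarrow> real) \<Rightarrow> (nat \<Rightarrow> nat \<Rightarrow> 'w \<Rightarrow> real) \<Rightarrow> nat \<Rightarrow> 'w \<Rightarrow> 'a \<Rightarrow> real"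
  where
  "truncated_field S a \<kappa> \<omega> x = (\<Sum>l\<le>\<kappa>. \<Sum>m=1..harmonic_dim l DIM('a). a l m \<omega> * S l m x)"

text \<open>The relation that defines the angular power spectrum \<open>A\<close> of \<open>T\<close>. The expansion
  is understood in \<open>L\<^sup>2(\<Omega> \<times> S)\<close>; this determines the coefficients \<open>a l m\<close> almost surely, as
  the inner products of \<open>T\<close> and \<open>S l m\<close>. Nonnegativity of \<open>A\<close> and convergence of
  \<open>\<Sum>l. A l * harmonic_dim l d\<close> follow.\<close>

definition karhunen_loeve ::
    "(nat \<Rightarrow> nat \<Rightarrow> 'a::euclidean_space \<Rightarrow> real) \<Rightarrow> 'w measure \<Rightarrow> ('w \<Rightarrow> 'a \<Rightarrow> real) \<Rightarrow>
     (nat \<Rightarrow> nat \<Rightarrow> 'w \<Rightarrow> real) \<Rightarrow> (nat \<Rightarrow> real) \<Rightarrow> bool" where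
  "karhunen_loeve S M T a A \<longleftrightarrow>
     prob_space.indep_vars M (\<lambda>_. borel) (\<lambda>(l, m). a l m)
       (SIGMA l:UNIV. {1..harmonic_dim l DIM('a)}) \<and>
     (\<forall>l. \<forall>m\<in>{1..harmonic_dim l DIM('a)}. gaussian_rv M (a l m) \<and> (\<integral>\<omega>. a l m \<omega> \<partial>M) = 0) \<and>
     (\<forall>l l'. \<forall>m\<in>{1..harmonic_dim l DIM('a)}. \<forall>m'\<in>{1..harmonic_dim l' DIM('a)}.
        (\<integral>\<omega>. a l m \<omega> * a l' m' \<omega> \<partial>M) = (if l = l' \<and> m = m' then A l else 0)) \<and>
     ((\<lambda>\<kappa>. \<integral>\<^sup>+(\<omega>, x). ennreal ((T \<omega> x - truncated_field S a \<kappa> \<omega> x)\<^sup>2)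
          \<partial>(M \<Otimes>\<^sub>M surface_measure)) \<longlonglongrightarrow> 0)"

end

theory Submission
  imports Defs
begin

text \<open>
  Everything about the error \<open>T - T\<^sup>\<kappa>\<close> is read off from the energies
  \<open>Y\<^sub>l = \<Sum>\<^sub>m a\<^sub>l\<^sub>m\<^sup>2\<close> of its degrees.

  Parseval's identity holds almost surely: \<open>\<parallel>T - T\<^sup>\<kappa>\<parallel>\<^sup>2 = \<Sum>\<^sub>l\<^sub>>\<^sub>\<kappa> Y\<^sub>l\<close>. The expansion converges only in
  \<open>L\<^sup>2(\<Omega> \<times> S)\<close>, but by Fatou's lemma the errors of almost every path have lower limit \<open>0\<close>. Such a
  path has the coefficients \<open>a\<^sub>l\<^sub>m\<close>, because its inner products with \<open>S\<^sub>l\<^sub>m\<close> and those of a late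
  truncation differ by at most the error (Bessel); and as the errors of orthogonal projections
  decrease, they tend to \<open>0\<close>. This is \<open>parseval_of_liminf\<close> and \<open>AE_parseval\<close>; almost sure
  convergence is part of it.

  The \<open>p\<close>-th moment of the error is controlled by the tail of the spectrum. For an integer \<open>n\<close>,
  Jensen's inequality with weights proportional to majorants \<open>t\<^sub>i\<close> of the variances bounds the \<open>n\<close>-th
  moment of \<open>\<Sum>\<^sub>i a\<^sub>i\<^sup>2\<close> by the even Gaussian moment of order \<open>2n\<close> times \<open>(\<Sum>\<^sub>i t\<^sub>i)\<^sup>n\<close>
  (\<open>moment_sum_squares_le\<close>). Fatou's lemma passes to the infinite tail, and \<open>x\<^sup>p \<le> 1 + x\<^sup>2\<^sup>n\<close>
  for \<open>p \<le> 2n\<close>, applied to the error divided by the square root of \<open>\<Sum>\<^sub>i t\<^sub>i\<close>, gives all real exponents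
  (\<open>remainder_moment\<close>).

  If \<open>\<alpha> > d - 1\<close>, the majorant \<open>C l\<^sup>-\<^sup>\<alpha>\<close> of the spectrum and the growth
  \<open>h(l, d) \<le> 2 (l d)\<^sup>d\<^sup>-\<^sup>2\<close> of the multiplicities make the tail at most a multiple of
  \<open>\<kappa>\<^sup>-\<^sup>(\<^sup>\<alpha>\<^sup>+\<^sup>1\<^sup>-\<^sup>d\<^sup>)\<close>, whence the rate in \<open>L\<^sup>p\<close>; the almost sure rate follows from the \<open>L\<^sup>p\<close> rate for a large
  \<open>p\<close> by Markov's inequality and the Borel-Cantelli lemma. If \<open>\<alpha> \<le> d - 1\<close>, the claimed bounds do not
  decrease in \<open>\<kappa>\<close>, and they follow from convergence alone.
\<close>

section \<open>Dimension of the spaces of spherical harmonics and tail sums\<close>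

lemma fact_add_le: "fact (l + k) \<le> (fact l * (l + k) ^ k :: nat)"
proof (induction k)
  case (Suc k)
  have "fact (l + Suc k) = (l + Suc k) * fact (l + k)" by simp
  also have "\<dots> \<le> (l + Suc k) * (fact l * (l + Suc k) ^ k)"
    using Suc by (intro mult_left_mono order_trans[OF Suc] power_mono) auto
  finally show ?case by (simp add: algebra_simps)
qed simp

lemma harmonic_dim_le:
  assumes "d \<ge> 2" "l \<ge> 1"
  shows "harmonic_dim l d \<le> 2 * (l * d) ^ (d - 2)"
proof -
  \<comment> \<open>The quotient \<open>(l + d - 3)! / l!\<close> has \<open>d - 3\<close> factors, each at most \<open>l d\<close>; for \<open>d = 2\<close> it is
    \<open>1 / l\<close> and the subtraction \<open>d - 3\<close> would truncate.\<close>
  have bound: "(2 * l + d - 2) * fact (l + d - 3) \<le> (2 * (l * d) ^ (d - 2)) * (fact (d - 2) * fact l)"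
  proof (cases "d = 2")
    case True
    then show ?thesis using assms by (cases l) auto
  next
    case False
    define k where "k = d - 3"
    have d: "d = k + 3" using False assms by (simp add: k_def)
    have a: "2 * l + d - 2 \<le> 2 * (l * d)"
      using assms by (cases l) (auto simp: d algebra_simps)
    have "l + k \<le> l * d"
      using assms by (cases l) (auto simp: d algebra_simps)
    then have "fact (l + k) \<le> fact l * (l * d) ^ k"
      by (intro order_trans[OF fact_add_le] mult_left_mono power_mono) auto
    then have "(2 * l + d - 2) * fact (l + k) \<le> 2 * (l * d) * (fact l * (l * d) ^ k)"
      using a by (intro mult_mono) auto
    also have "\<dots> = (2 * (l * d) ^ (d - 2)) * (1 * fact l)"
      by (simp add: d)
    also have "\<dots> \<le> (2 * (l * d) ^ (d - 2)) * (fact (d - 2) * fact l)"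
      by (intro mult_left_mono mult_right_mono) (auto simp: fact_ge_1)
    finally show ?thesis by (simp add: d)
  qed
  then have "(2 * l + d - 2) * fact (l + d - 3) div (fact (d - 2) * fact l) \<le> 2 * (l * d) ^ (d - 2)"
    using div_le_mono[OF bound, of "fact (d - 2) * fact l"] by (simp only: nonzero_mult_div_cancel_right mult_eq_0_iff fact_nonzero simp_thms)
  then show ?thesis using assms by (simp add: harmonic_dim_def)
qed

text \<open>By the mean value theorem the right-hand side is \<open>z\<^sup>-\<^sup>\<gamma>\<close> for some \<open>z\<close> between \<open>l\<close> and
  \<open>l + 1\<close>. Summed over \<open>l\<close>, the right-hand sides telescope.\<close>
lemma powr_le_telescope:
  assumes "\<gamma> > (1::real)" "l \<ge> 1"
  shows "real (Suc l) powr - \<gamma> \<le> (real l powr (1 - \<gamma>) - real (Suc l) powr (1 - \<gamma>)) / (\<gamma> - 1)"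
proof -
  obtain z where z: "real l < z" "z < real (Suc l)"
    and eq: "real (Suc l) powr (1 - \<gamma>) - real l powr (1 - \<gamma>) = (real (Suc l) - real l) * ((1 - \<gamma>) * z powr (1 - \<gamma> - 1))"
    using assms
    using MVT2[of "real l" "real (Suc l)" "\<lambda>x. x powr (1 - \<gamma>)" "\<lambda>x. (1 - \<gamma>) * x powr (1 - \<gamma> - 1)",
      OF _ has_real_derivative_powr] 
    by (auto simp del: of_nat_Suc)
  have "real (Suc l) powr - \<gamma> \<le> z powr - \<gamma>"
    using z assms by (intro powr_mono2') auto
  also have "z powr - \<gamma> = (real l powr (1 - \<gamma>) - real (Suc l) powr (1 - \<gamma>)) / (\<gamma> - 1)"
    using eq assms by (simp add: field_simps)
  finally show ?thesis .
qed

lemma sum_powr_tail_le: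
  assumes "\<gamma> > (1::real)" "k \<ge> 1"
  shows "(\<Sum>l\<in>{k<..<n}. real l powr - \<gamma>) \<le> real k powr (1 - \<gamma>) / (\<gamma> - 1)"
proof -
  \<comment> \<open>The largest index is \<open>n - 1\<close>; the maximum makes the right-hand side \<open>0\<close> if the sum is empty.\<close>
  have "(\<Sum>l\<in>{k<..<n}. real l powr - \<gamma>) \<le> (real k powr (1 - \<gamma>) - real (max k (n - 1)) powr (1 - \<gamma>)) / (\<gamma> - 1)"
  proof (induction n)
    case (Suc n)
    show ?case
    proof (cases "k < n")
      case True
      then have "{k<..<Suc n} = insert n {k<..<n}" by auto
      then show ?thesis 
        using Suc True powr_le_telescope[OF assms(1), of "n - 1"] assms(2)
        by (simp add: max_def diff_divide_distrib Suc_diff_Suc split: if_splits)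
    next
      case False
      then have "{k<..<Suc n} = {}" by auto
      then show ?thesis using False by (simp add: max_def)
    qed
  qed simp
  also have "\<dots> \<le> real k powr (1 - \<gamma>) / (\<gamma> - 1)"
    using assms by (intro divide_right_mono) auto
  finally show ?thesis .
qed

text \<open>With multiplicities at most \<open>2 (l d)\<^sup>d\<^sup>-\<^sup>2\<close> and the spectrum \<open>l\<^sup>-\<^sup>\<alpha>\<close>, the tail after degree \<open>\<kappa>\<close>
  is at most this constant times \<open>\<kappa>\<^sup>-\<^sup>(\<^sup>\<alpha>\<^sup>+\<^sup>1\<^sup>-\<^sup>d\<^sup>)\<close>.\<close>
definition rate_constant :: "nat \<Rightarrow> real \<Rightarrow> real" where
  "rate_constant d \<alpha> = 2 * real d ^ (d - 2) / (\<alpha> + 1 - real d)"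

lemma rate_constant_pos: "0 < d \<Longrightarrow> real d - 1 < \<alpha> \<Longrightarrow> 0 < rate_constant d \<alpha>"
  by (simp add: rate_constant_def)

section \<open>Finite orthonormal expansions\<close>

lemma integrable_mult_of_squares:
  fixes f g :: "'x \<Rightarrow> real"
  assumes [measurable]: "f \<in> borel_measurable N" "g \<in> borel_measurable N"
    and "integrable N (\<lambda>x. (f x)\<^sup>2)" "integrable N (\<lambda>x. (g x)\<^sup>2)"
  shows "integrable N (\<lambda>x. f x * g x)"
proof (rule Bochner_Integration.integrable_bound)
  show "integrable N (\<lambda>x. (f x)\<^sup>2 + (g x)\<^sup>2)" using assms by simp
  have "\<bar>a * b\<bar> \<le> a\<^sup>2 + b\<^sup>2" for a b :: real
    using sum_squares_bound[of "\<bar>a\<bar>" "\<bar>b\<bar>"] abs_ge_zero[of "a * b"]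
    unfolding abs_mult power2_abs mult.assoc by linarith
  then show "AE x in N. norm (f x * g x) \<le> norm ((f x)\<^sup>2 + (g x)\<^sup>2)" by auto
qed simp

locale orthonormal_family =
  fixes N :: "'x measure" and I :: "'i set" and e :: "'i \<Rightarrow> 'x \<Rightarrow> real"
  assumes basis_measurable [measurable]: "i \<in> I \<Longrightarrow> e i \<in> borel_measurable N"
    and orthonormal: "i \<in> I \<Longrightarrow> j \<in> I \<Longrightarrow> (\<integral>x. e i x * e j x \<partial>N) = (if i = j then 1 else 0)"
begin

text \<open>The Bochner integral of a non-integrable function is \<open>0\<close>, so that a square with integral \<open>1\<close> is
  integrable.\<close>
lemma basis_square_integrable:
  assumes "i \<in> I" shows "integrable N (\<lambda>x. (e i x)\<^sup>2)"
  using orthonormal[OF assms assms] not_integrable_integral_eq[of N "\<lambda>x. e i x * e i x"]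
  by (auto simp: power2_eq_square)

text \<open>The three facts are proved together, by removing one basis function at a time: the new squared
  norm involves the inner product of the current remainder with the next basis function, and by
  orthogonality this is still the inner product of \<open>f\<close>.\<close>
lemma subtract_expansion:
  assumes "finite J" "J \<subseteq> I"
    and f [measurable]: "f \<in> borel_measurable N" and f2: "integrable N (\<lambda>x. (f x)\<^sup>2)"
  shows "integrable N (\<lambda>x. (f x - (\<Sum>i\<in>J. c i * e i x))\<^sup>2)"
    and "i \<in> I \<Longrightarrow> (\<integral>x. (f x - (\<Sum>i\<in>J. c i * e i x)) * e i x \<partial>N) =
           (\<integral>x. f x * e i x \<partial>N) - (if i \<in> J then c i else 0)"
    and "(\<integral>x. (f x - (\<Sum>i\<in>J. c i * e i x))\<^sup>2 \<partial>N) =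
           (\<integral>x. (f x)\<^sup>2 \<partial>N) - 2 * (\<Sum>i\<in>J. c i * (\<integral>x. f x * e i x \<partial>N)) + (\<Sum>i\<in>J. (c i)\<^sup>2)"
proof -
  let ?F = "\<lambda>J x. f x - (\<Sum>i\<in>J. c i * e i x)"
  have "integrable N (\<lambda>x. (?F J x)\<^sup>2) \<and>
    (\<forall>i\<in>I. (\<integral>x. ?F J x * e i x \<partial>N) = (\<integral>x. f x * e i x \<partial>N) - (if i \<in> J then c i else 0)) \<and>
    (\<integral>x. (?F J x)\<^sup>2 \<partial>N) = 
       (\<integral>x. (f x)\<^sup>2 \<partial>N) - 2 * (\<Sum>i\<in>J. c i * (\<integral>x. f x * e i x \<partial>N)) + (\<Sum>i\<in>J. (c i)\<^sup>2)"
    using assms(1,2)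
  proof (induction J rule: finite_induct)
    case empty
    then show ?case using f2 by simp
  next
    case (insert j J)
    then have j [simp]: "j \<in> I" and J: "J \<subseteq> I" by auto
    note [measurable] = basis_measurable[OF j]
    have [measurable]: "?F J \<in> borel_measurable N" using J by (auto intro!: borel_measurable_diff borel_measurable_sum borel_measurable_times)
    have F2: "integrable N (\<lambda>x. (?F J x)\<^sup>2)" using insert J by blast
    have ej: "integrable N (\<lambda>x. (e j x)\<^sup>2)" by (rule basis_square_integrable[OF j])
    have Fe: "integrable N (\<lambda>x. ?F J x * e i x)" if "i \<in> I" for i
      using that F2 by (intro integrable_mult_of_squares basis_square_integrable) auto
    have ee: "integrable N (\<lambda>x. e j x * e i x)" if "i \<in> I" for i
      using that ej by (intro integrable_mult_of_squares basis_square_integrable) auto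
    have F': "?F (insert j J) x = ?F J x - c j * e j x" for x
      using insert(1,2) by simp
    have sq: "(\<lambda>x. (?F (insert j J) x)\<^sup>2) =
        (\<lambda>x. (?F J x)\<^sup>2 - 2 * c j * (?F J x * e j x) + (c j)\<^sup>2 * (e j x)\<^sup>2)"
      unfolding F' by (simp add: power2_eq_square algebra_simps)
    have mul: "(\<lambda>x. ?F (insert j J) x * e i x) = (\<lambda>x. ?F J x * e i x - c j * (e j x * e i x))" for i
      unfolding F' by (simp add: algebra_simps)
    have ips: "(\<integral>x. ?F J x * e i x \<partial>N) = (\<integral>x. f x * e i x \<partial>N) - (if i \<in> J then c i else 0)" if "i \<in> I" for i
      using insert J that by blast
    have "integrable N (\<lambda>x. (?F (insert j J) x)\<^sup>2)"
      unfolding sq using F2 ej Fe[OF j] by simp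
    moreover have "(\<integral>x. ?F (insert j J) x * e i x \<partial>N) =
        (\<integral>x. f x * e i x \<partial>N) - (if i \<in> insert j J then c i else 0)" if i: "i \<in> I" for i
      unfolding mul using Fe[OF i] ee[OF i] ips[OF i] orthonormal[OF j i] insert(2)
      by auto
    moreover have "(\<integral>x. (?F (insert j J) x)\<^sup>2 \<partial>N) =
        (\<integral>x. (?F J x)\<^sup>2 \<partial>N) - 2 * c j * (\<integral>x. f x * e j x \<partial>N) + (c j)\<^sup>2"
      unfolding sq using F2 ej Fe[OF j] ips[OF j] orthonormal[OF j j] insert(2)
      by (simp add: power2_eq_square)
    ultimately show ?case
      using insert J by (simp add: algebra_simps)
  qed
  then show "integrable N (\<lambda>x. (?F J x)\<^sup>2)"
    and "i \<in> I \<Longrightarrow> (\<integral>x. (?F J x) * e i x \<partial>N) =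
           (\<integral>x. f x * e i x \<partial>N) - (if i \<in> J then c i else 0)"
    and "(\<integral>x. (?F J x)\<^sup>2 \<partial>N) =
           (\<integral>x. (f x)\<^sup>2 \<partial>N) - 2 * (\<Sum>i\<in>J. c i * (\<integral>x. f x * e i x \<partial>N)) + (\<Sum>i\<in>J. (c i)\<^sup>2)"
    by blast+
qed

lemma finite_expansion:
  assumes "finite J" "J \<subseteq> I"
  shows "integrable N (\<lambda>x. (\<Sum>i\<in>J. c i * e i x)\<^sup>2)"
    and "(\<integral>x. (\<Sum>i\<in>J. c i * e i x)\<^sup>2 \<partial>N) = (\<Sum>i\<in>J. (c i)\<^sup>2)"
  using subtract_expansion(1,3)[OF assms, of "\<lambda>_. 0" c] by simp_all

lemma bessel:
  assumes "i \<in> I" "f \<in> borel_measurable N" "integrable N (\<lambda>x. (f x)\<^sup>2)"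
  shows "(\<integral>x. f x * e i x \<partial>N)\<^sup>2 \<le> (\<integral>x. (f x)\<^sup>2 \<partial>N)"
proof -
  have "0 \<le> (\<integral>x. (f x - (\<Sum>j\<in>{i}. (\<integral>x. f x * e i x \<partial>N) * e j x))\<^sup>2 \<partial>N)"
    by simp
  then show ?thesis
    using assms(1) by (subst (asm) subtract_expansion(3)[OF _ _ assms(2,3)]) (auto simp: power2_eq_square)
qed

text \<open>The partial sums need to approach \<open>f\<close> only along a subsequence, which may depend on \<open>f\<close>: this is
  what convergence in the mean provides for almost every path of a random field. The given numbers
  \<open>c\<close> are then the Fourier coefficients of \<open>f\<close>, and since the errors decrease, the whole sequence
  converges.\<close>
lemma parseval_of_liminf:
  assumes J: "\<And>n. finite (J n)" "\<And>n. J n \<subseteq> I" "incseq J"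
    and f [measurable]: "f \<in> borel_measurable N"
    and lim: "liminf (\<lambda>n. \<integral>\<^sup>+x. ennreal ((f x - (\<Sum>i\<in>J n. c i * e i x))\<^sup>2) \<partial>N) = 0"
  shows "integrable N (\<lambda>x. (f x)\<^sup>2)"
    and "(\<integral>x. (f x - (\<Sum>i\<in>J n. c i * e i x))\<^sup>2 \<partial>N) = (\<integral>x. (f x)\<^sup>2 \<partial>N) - (\<Sum>i\<in>J n. (c i)\<^sup>2)"
    and "(\<lambda>n. \<integral>x. (f x - (\<Sum>i\<in>J n. c i * e i x))\<^sup>2 \<partial>N) \<longlonglongrightarrow> 0"
proof -
  define s where "s n x = (\<Sum>i\<in>J n. c i * e i x)" for n x
  define r where "r n = (\<integral>x. (f x - s n x)\<^sup>2 \<partial>N)" for n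
  have s [measurable]: "s n \<in> borel_measurable N" for n
    unfolding s_def using J(2)[of n] by (auto intro!: borel_measurable_sum borel_measurable_times)
  have s2: "integrable N (\<lambda>x. (s n x)\<^sup>2)" for n
    unfolding s_def using finite_expansion(1)[OF J(1,2)] .
  have small: "\<exists>n\<ge>m. (\<integral>\<^sup>+x. ennreal ((f x - s n x)\<^sup>2) \<partial>N) < ennreal \<epsilon>" if "\<epsilon> > 0" for \<epsilon> m
  proof (rule ccontr)
    assume "\<not> ?thesis"
    then have "ennreal \<epsilon> \<le> liminf (\<lambda>n. \<integral>\<^sup>+x. ennreal ((f x - s n x)\<^sup>2) \<partial>N)"
      by (intro Liminf_bounded) (auto simp: eventually_sequentially not_less)
    then show False using lim that by (simp add: s_def)
  qed
  obtain n0 where "(\<integral>\<^sup>+x. ennreal ((f x - s n0 x)\<^sup>2) \<partial>N) < ennreal 1" using small[of 1 0] by auto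
  then have d0: "integrable N (\<lambda>x. (f x - s n0 x)\<^sup>2)"
    by (intro integrableI_nonneg) (auto intro: less_trans)
  have "integrable N (\<lambda>x. (f x - s n0 x)\<^sup>2 + 2 * ((f x - s n0 x) * s n0 x) + (s n0 x)\<^sup>2)"
    using d0 s2[of n0] integrable_mult_of_squares[OF _ _ d0 s2[of n0]] by simp
  then show f2: "integrable N (\<lambda>x. (f x)\<^sup>2)"
    by (simp add: power2_eq_square algebra_simps)
  have d2: "integrable N (\<lambda>x. (f x - s n x)\<^sup>2)" for n
    unfolding s_def by (rule subtract_expansion(1)[OF J(1,2) f f2])
  have r_small: "\<exists>n\<ge>m. r n < \<epsilon>" if "\<epsilon> > 0" for \<epsilon> m
  proof -
    obtain n where "n \<ge> m" and n: "(\<integral>\<^sup>+x. ennreal ((f x - s n x)\<^sup>2) \<partial>N) < ennreal \<epsilon>"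
      using \<open>\<epsilon> > 0\<close> small[of \<epsilon> m] by auto
    have "ennreal (r n) < ennreal \<epsilon>"
      using n by (simp add: nn_integral_eq_integral[OF d2] r_def)
    then show ?thesis using \<open>n \<ge> m\<close> by (auto simp: ennreal_less_iff r_def)
  qed
  \<comment> \<open>For all \<open>n \<ge> m\<close> the inner product of \<open>f - s n\<close> with \<open>e i\<close> is \<open>\<langle>f, e i\<rangle> - c i\<close>, but by Bessel's
    inequality its square is at most \<open>r n\<close>, which is arbitrarily small for some such \<open>n\<close>.\<close>
  have coeff: "(\<integral>x. f x * e i x \<partial>N) = c i" if i: "i \<in> J m" for i m
  proof (rule ccontr)
    assume "(\<integral>x. f x * e i x \<partial>N) \<noteq> c i"
    then obtain n where n: "n \<ge> m" "r n < ((\<integral>x. f x * e i x \<partial>N) - c i)\<^sup>2"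
      using r_small[of "((\<integral>x. f x * e i x \<partial>N) - c i)\<^sup>2" m] by auto
    have "i \<in> J n" using incseqD[OF J(3) n(1)] i by auto
    then have "(\<integral>x. (f x - s n x) * e i x \<partial>N) = (\<integral>x. f x * e i x \<partial>N) - c i"
      using subtract_expansion(2)[OF J(1,2) f f2, where c=c and i=i] J(2)[of n] by (auto simp: s_def)
    then show False
      using bessel[of i "\<lambda>x. f x - s n x"] d2[of n] n \<open>i \<in> J n\<close> J(2)[of n] by (auto simp: r_def)
  qed
  have r_eq: "r n = (\<integral>x. (f x)\<^sup>2 \<partial>N) - (\<Sum>i\<in>J n. (c i)\<^sup>2)" for n
  proof -
    have "(\<Sum>i\<in>J n. c i * (\<integral>x. f x * e i x \<partial>N)) = (\<Sum>i\<in>J n. (c i)\<^sup>2)"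
      by (intro sum.cong refl) (simp add: coeff power2_eq_square)
    then show ?thesis
      unfolding r_def s_def subtract_expansion(3)[OF J(1,2) f f2] by simp
  qed
  then show "(\<integral>x. (f x - (\<Sum>i\<in>J n. c i * e i x))\<^sup>2 \<partial>N) = (\<integral>x. (f x)\<^sup>2 \<partial>N) - (\<Sum>i\<in>J n. (c i)\<^sup>2)"
    by (simp add: r_def s_def)
  have "r n \<le> r m" if "m \<le> n" for m n
    unfolding r_eq using incseqD[OF J(3) that] J(1)[of n] by (auto intro: sum_mono2)
  then have "r \<longlonglongrightarrow> 0"
  proof (intro LIMSEQ_I)
    fix \<epsilon> :: real assume mono: "\<And>m n. m \<le> n \<Longrightarrow> r n \<le> r m" and "0 < \<epsilon>"
    then obtain m where "r m < \<epsilon>" using r_small[of \<epsilon> 0] by auto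
    then have "norm (r n - 0) < \<epsilon>" if "n \<ge> m" for n
      using mono[OF that] by (simp add: r_def)
    then show "\<exists>m. \<forall>n\<ge>m. norm (r n - 0) < \<epsilon>" by blast
  qed
  then show "(\<lambda>n. \<integral>x. (f x - (\<Sum>i\<in>J n. c i * e i x))\<^sup>2 \<partial>N) \<longlonglongrightarrow> 0"
    by (simp add: r_def[abs_def] s_def)
qed

end

section \<open>Moments of sums of squares of Gaussian variables\<close>

text \<open>The moment of order \<open>2 n\<close> of the standard normal distribution, i.e. \<open>1 \<cdot> 3 \<cdots> (2 n - 1)\<close>.\<close>
definition gaussian_even_moment :: "nat \<Rightarrow> real" where
  "gaussian_even_moment n = fact (2 * n) / (2 ^ n * fact n)"

lemma gaussian_even_moment_pos: "gaussian_even_moment n > 0"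
  by (simp add: gaussian_even_moment_def)

text \<open>A constant variable of mean \<open>0\<close> vanishes and fits the formula for normal variables.\<close>
lemma centred_gaussian_even_moment:
  assumes X: "gaussian_rv M X" and mean: "(\<integral>\<omega>. X \<omega> \<partial>M) = 0"
  shows "integrable M (\<lambda>\<omega>. X \<omega> ^ (2 * n))"
    and "(\<integral>\<omega>. X \<omega> ^ (2 * n) \<partial>M) = gaussian_even_moment n * (\<integral>\<omega>. (X \<omega>)\<^sup>2 \<partial>M) ^ n"
proof -
  have [measurable]: "X \<in> borel_measurable M" using X by (simp add: gaussian_rv_def)
  have distr_int: "integrable M (\<lambda>\<omega>. g (X \<omega>)) \<longleftrightarrow> integrable (distr M borel X) g"
    "(\<integral>\<omega>. g (X \<omega>) \<partial>M) = (\<integral>x. g x \<partial>distr M borel X)"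
    if [measurable]: "g \<in> borel_measurable borel" for g :: "real \<Rightarrow> real"
    by (simp_all add: integrable_distr_eq integral_distr)
  obtain \<mu> s where "distr M borel X = return borel \<mu> \<or>
      s > 0 \<and> distr M borel X = density lborel (\<lambda>y. ennreal (normal_density \<mu> s y))"
    using X by (auto simp: gaussian_rv_def)
  then consider (const) "distr M borel X = return borel \<mu>"
    | (normal) "s > 0" "distr M borel X = density lborel (\<lambda>y. ennreal (normal_density \<mu> s y))" by blast
  then have "integrable M (\<lambda>\<omega>. X \<omega> ^ (2 * n)) \<and>
    (\<integral>\<omega>. X \<omega> ^ (2 * n) \<partial>M) = gaussian_even_moment n * (\<integral>\<omega>. (X \<omega>)\<^sup>2 \<partial>M) ^ n"
  proof cases
    case const
    have "\<mu> = 0"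
      using mean distr_int(2)[of "\<lambda>x. x"] by (simp add: const integral_return)
    then show ?thesis
      using distr_int[of "\<lambda>x. x ^ (2 * n)"] distr_int(2)[of "\<lambda>x. x\<^sup>2"]
      by (cases "n = 0") (simp_all add: const integral_return integrable_iff_bounded nn_integral_return measure_return power_0_left gaussian_even_moment_def)
  next
    case normal
    have "\<mu> = 0"
      using mean distr_int(2)[of "\<lambda>x. x"] normal
      by (simp add: integral_density integral_normal_moment_nz_1)
    then have mom: "has_bochner_integral M (\<lambda>\<omega>. X \<omega> ^ (2 * k)) (fact (2 * k) / ((2 / s\<^sup>2) ^ k * fact k))" for k
      using normal_moment_even[OF normal(1), of 0 k] distr_int[of "\<lambda>x. x ^ (2 * k)"]
      by (simp add: normal(2) has_bochner_integral_iff integrable_density integral_density)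
    have "(\<integral>\<omega>. (X \<omega>)\<^sup>2 \<partial>M) = s\<^sup>2"
      using mom[of 1] by (simp add: has_bochner_integral_iff)
    then show ?thesis
      using mom[of n] normal(1)
      by (simp add: has_bochner_integral_iff gaussian_even_moment_def power_divide)
  qed
  then show "integrable M (\<lambda>\<omega>. X \<omega> ^ (2 * n))"
    "(\<integral>\<omega>. X \<omega> ^ (2 * n) \<partial>M) = gaussian_even_moment n * (\<integral>\<omega>. (X \<omega>)\<^sup>2 \<partial>M) ^ n" by auto
qed

lemma convex_on_power_nonneg: "convex_on {0::real..} (\<lambda>x. x ^ n)"
proof (cases "even n")
  case True
  then show ?thesis by (intro convex_on_subset[OF convex_power_even]) auto
qed (rule convex_power_odd)

text \<open>Jensen's inequality for \<open>x \<mapsto> x\<^sup>n\<close>, with the weights \<open>t i / sum t J\<close> at the points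
  \<open>y i / t i\<close>.\<close>
lemma sum_power_le_weighted:
  fixes t y :: "'i \<Rightarrow> real"
  assumes J: "finite J" "J \<noteq> {}" and t: "\<And>i. i \<in> J \<Longrightarrow> t i > 0" and y: "\<And>i. i \<in> J \<Longrightarrow> y i \<ge> 0"
  shows "(\<Sum>i\<in>J. y i) ^ n \<le> sum t J ^ n * (\<Sum>i\<in>J. t i / sum t J * (y i / t i) ^ n)"
proof -
  have pos: "sum t J > 0" using J t by (intro sum_pos) auto
  have "(\<Sum>i\<in>J. (t i / sum t J) *\<^sub>R (y i / t i)) ^ n \<le> (\<Sum>i\<in>J. t i / sum t J * (y i / t i) ^ n)"
    using pos t y J by (intro convex_on_sum[OF J convex_on_power_nonneg])
      (auto simp: sum_divide_distrib[symmetric] less_imp_le)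
  moreover have "(\<Sum>i\<in>J. (t i / sum t J) *\<^sub>R (y i / t i)) = (\<Sum>i\<in>J. y i) / sum t J"
    unfolding sum_divide_distrib by (intro sum.cong refl) (use t in \<open>force dest: less_imp_neq\<close>)
  ultimately have "((\<Sum>i\<in>J. y i) / sum t J) ^ n \<le> (\<Sum>i\<in>J. t i / sum t J * (y i / t i) ^ n)"
    by simp
  then show ?thesis
    using pos by (simp only: power_divide pos_divide_le_eq zero_less_power mult.commute)
qed

text \<open>Positive majorants \<open>t\<close> of the variances, instead of the
  variances themselves, admit degenerate variables: Jensen's inequality is applied to the quotients
  \<open>(a i)\<^sup>2 / t i\<close>, with weights proportional to \<open>t i\<close>.\<close>
lemma moment_sum_squares_le:
  fixes a :: "'i \<Rightarrow> 'w \<Rightarrow> real"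
  assumes J: "finite J"
    and gauss: "\<And>i. i \<in> J \<Longrightarrow> gaussian_rv M (a i)" "\<And>i. i \<in> J \<Longrightarrow> (\<integral>\<omega>. a i \<omega> \<partial>M) = 0"
    and t: "\<And>i. i \<in> J \<Longrightarrow> 0 < t i" "\<And>i. i \<in> J \<Longrightarrow> (\<integral>\<omega>. (a i \<omega>)\<^sup>2 \<partial>M) \<le> t i"
    and s: "sum t J \<le> s" and n: "n \<ge> 1"
  shows "(\<integral>\<^sup>+\<omega>. ennreal ((\<Sum>i\<in>J. (a i \<omega>)\<^sup>2) ^ n) \<partial>M) \<le> ennreal (gaussian_even_moment n * s ^ n)"
proof (cases "J = {}")
  case True
  then show ?thesis using n by (simp add: power_0_left)
next
  case False
  define W where "W = sum t J"
  have pos: "W > 0" unfolding W_def using J t False by (intro sum_pos) auto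
  have [measurable]: "i \<in> J \<Longrightarrow> a i \<in> borel_measurable M" for i using gauss by (simp add: gaussian_rv_def)
  let ?B = "\<lambda>\<omega>. W ^ n * (\<Sum>i\<in>J. t i / W * ((a i \<omega>) ^ (2 * n) / t i ^ n))"
  have int: "i \<in> J \<Longrightarrow> integrable M (\<lambda>\<omega>. a i \<omega> ^ (2 * n))" for i
    using centred_gaussian_even_moment(1)[OF gauss] .
  then have intB: "integrable M ?B" by auto
  have "(\<integral>\<^sup>+\<omega>. ennreal ((\<Sum>i\<in>J. (a i \<omega>)\<^sup>2) ^ n) \<partial>M) \<le> (\<integral>\<^sup>+\<omega>. ennreal (?B \<omega>) \<partial>M)"
    using sum_power_le_weighted[OF J False t(1), where y="\<lambda>i. (a i \<omega>)\<^sup>2" for \<omega>]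
    by (intro nn_integral_mono ennreal_leI) (simp add: W_def power_divide power_mult)
  also have "\<dots> = ennreal (\<integral>\<omega>. ?B \<omega> \<partial>M)"
    using intB pos t by (intro nn_integral_eq_integral) (auto intro!: mult_nonneg_nonneg sum_nonneg divide_nonneg_nonneg simp: less_imp_le)
  also have "(\<integral>\<omega>. ?B \<omega> \<partial>M) = W ^ n * (\<Sum>i\<in>J. t i / W * ((\<integral>\<omega>. a i \<omega> ^ (2 * n) \<partial>M) / t i ^ n))"
    using int by simp
  also have "\<dots> \<le> W ^ n * (\<Sum>i\<in>J. t i / W * gaussian_even_moment n)"
  proof (intro mult_left_mono sum_mono)
    fix i assume i: "i \<in> J"
    have "(\<integral>\<omega>. a i \<omega> ^ (2 * n) \<partial>M) \<le> gaussian_even_moment n * t i ^ n"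
      unfolding centred_gaussian_even_moment(2)[OF gauss[OF i]]
      using t(2)[OF i] gaussian_even_moment_pos[of n] by (intro mult_left_mono power_mono) auto
    then show "(\<integral>\<omega>. a i \<omega> ^ (2 * n) \<partial>M) / t i ^ n \<le> gaussian_even_moment n"
      using t(1)[OF i] by (simp add: field_simps)
    show "0 \<le> t i / W" using t(1)[OF i] pos by simp
  qed (use pos in auto)
  also have "\<dots> = gaussian_even_moment n * W ^ n"
    using pos by (simp add: sum_distrib_right[symmetric] sum_divide_distrib[symmetric] W_def)
  also have "\<dots> \<le> gaussian_even_moment n * s ^ n"
    using s pos gaussian_even_moment_pos[of n] by (intro mult_left_mono power_mono) (auto simp: W_def)
  finally show ?thesis by (simp add: ennreal_leI)
qed

section \<open>From moments to almost sure rates\<close>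

text \<open>The pointwise bound \<open>x\<^sup>p \<le> 1 + x\<^sup>2\<^sup>n\<close> for \<open>x = X / s\<close> reduces a real exponent to an even one.\<close>
lemma integral_powr_le_of_even_moment:
  fixes X :: "'w \<Rightarrow> real"
  assumes M: "prob_space M" and X [measurable]: "X \<in> borel_measurable M" "\<And>\<omega>. 0 \<le> X \<omega>"
    and p: "1 \<le> p" "p \<le> 2 * real n" and s: "0 < s" and C: "0 \<le> C"
    and mom: "(\<integral>\<^sup>+\<omega>. ennreal (X \<omega> ^ (2 * n)) \<partial>M) \<le> ennreal (C * s ^ (2 * n))"
  shows "integrable M (\<lambda>\<omega>. X \<omega> powr p)" and "(\<integral>\<omega>. X \<omega> powr p \<partial>M) \<le> s powr p * (1 + C)"
proof -
  interpret prob_space M by fact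
  have int: "integrable M (\<lambda>\<omega>. X \<omega> ^ (2 * n))"
    using mom X by (intro integrableI_nonneg) (auto simp: le_less_trans less_top)
  have "ennreal (\<integral>\<omega>. X \<omega> ^ (2 * n) \<partial>M) \<le> ennreal (C * s ^ (2 * n))"
    using mom by (subst nn_integral_eq_integral[symmetric, OF int]) auto
  then have mom': "(\<integral>\<omega>. X \<omega> ^ (2 * n) \<partial>M) \<le> C * s ^ (2 * n)"
    using C s by (subst (asm) ennreal_le_iff) auto
  let ?B = "\<lambda>\<omega>. s powr p * (1 + X \<omega> ^ (2 * n) / s ^ (2 * n))"
  have dom: "X \<omega> powr p \<le> ?B \<omega>" for \<omega>
  proof -
    have "(X \<omega> / s) powr p \<le> 1 + (X \<omega> / s) ^ (2 * n)"
    proof (cases "X \<omega> / s \<le> 1")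
      case True
      then have "(X \<omega> / s) powr p \<le> 1 powr p" using p s X(2)[of \<omega>] by (intro powr_mono2) auto
      then show ?thesis using X(2)[of \<omega>] s by (simp add: add_increasing2)
    next
      case False
      then have "(X \<omega> / s) powr p \<le> (X \<omega> / s) powr (real (2 * n))" using p by (intro powr_mono) auto
      also have "\<dots> = (X \<omega> / s) ^ (2 * n)" using False s by (intro powr_realpow) simp
      finally show ?thesis by simp
    qed
    then have "s powr p * (X \<omega> / s) powr p \<le> ?B \<omega>"
      by (intro mult_left_mono) (auto simp: power_divide)
    then show ?thesis using s X(2)[of \<omega>] by (simp add: powr_divide)
  qed
  have intB: "integrable M ?B" using int by simp
  show intX: "integrable M (\<lambda>\<omega>. X \<omega> powr p)"
    using dom by (intro Bochner_Integration.integrable_bound[OF intB]) (auto intro: order_trans[OF _ abs_ge_self])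
  have "(\<integral>\<omega>. X \<omega> powr p \<partial>M) \<le> (\<integral>\<omega>. ?B \<omega> \<partial>M)"
    using dom by (intro integral_mono intX intB)
  also have "\<dots> = s powr p * (1 + (\<integral>\<omega>. X \<omega> ^ (2 * n) \<partial>M) / s ^ (2 * n))"
    using int by (simp add: prob_space)
  also have "\<dots> \<le> s powr p * (1 + C)"
    using mom' s by (intro mult_left_mono add_left_mono) (auto simp: field_simps)
  finally show "(\<integral>\<omega>. X \<omega> powr p \<partial>M) \<le> s powr p * (1 + C)" .
qed

text \<open>By Markov's inequality \<open>X k\<close> exceeds \<open>k\<^sup>-\<^sup>\<beta>\<close> with probability at most
  \<open>c k\<^sup>-\<^sup>p\<^sup>(\<^sup>\<beta>\<^sup>'\<^sup>-\<^sup>\<beta>\<^sup>)\<close>. This is summable, and the Borel-Cantelli lemma applies.\<close>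
lemma AE_eventually_le_powr:
  fixes X :: "nat \<Rightarrow> 'w \<Rightarrow> real"
  assumes M: "prob_space M" and X [measurable]: "\<And>k. X k \<in> borel_measurable M" "\<And>k \<omega>. 0 \<le> X k \<omega>"
    and int: "\<And>k. integrable M (\<lambda>\<omega>. X k \<omega> powr p)"
    and mom: "\<And>k. k \<ge> N \<Longrightarrow> (\<integral>\<omega>. X k \<omega> powr p \<partial>M) \<le> c * real k powr - (p * \<beta>')"
    and p: "p > 0" "p * (\<beta>' - \<beta>) > 1"
  shows "AE \<omega> in M. \<forall>\<^sub>F k in sequentially. X k \<omega> \<le> real k powr - \<beta>"
proof -
  interpret prob_space M by fact
  define E where "E k = {\<omega> \<in> space M. real k powr - (p * \<beta>) \<le> X k \<omega> powr p}" for k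
  have [measurable]: "E k \<in> sets M" for k unfolding E_def by measurable
  have bound: "measure M (E k) \<le> c * real k powr - (p * (\<beta>' - \<beta>))" if k: "k \<ge> max 1 N" for k
  proof -
    have "measure M (E k) \<le> (\<integral>\<omega>. X k \<omega> powr p \<partial>M) / (real k powr - (p * \<beta>))"
      unfolding E_def using int k by (intro integral_Markov_inequality_measure[where A="{}"]) auto
    also have "\<dots> \<le> (c * real k powr - (p * \<beta>')) / (real k powr - (p * \<beta>))"
      using mom k by (intro divide_right_mono) auto
    also have "\<dots> = c * real k powr (- (p * \<beta>') - - (p * \<beta>))"
      by (simp only: powr_diff times_divide_eq_right)
    also have "- (p * \<beta>') - - (p * \<beta>) = - (p * (\<beta>' - \<beta>))" by (simp add: algebra_simps)
    finally show ?thesis .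
  qed
  have "summable (\<lambda>k. c * real k powr - (p * (\<beta>' - \<beta>)))"
    using p by (intro summable_mult) (simp add: summable_real_powr_iff)
  then have "summable (\<lambda>k. measure M (E k))"
    by (rule summable_comparison_test'[where N="max 1 N"]) (use bound in auto)
  then have "AE \<omega> in M. \<forall>\<^sub>F k in sequentially. \<omega> \<in> space M - E k"
    by (intro borel_cantelli_AE1) (auto simp: emeasure_eq_measure)
  then show ?thesis
  proof (rule AE_mp, intro AE_I2 impI)
    fix \<omega> assume "\<forall>\<^sub>F k in sequentially. \<omega> \<in> space M - E k"
    then show "\<forall>\<^sub>F k in sequentially. X k \<omega> \<le> real k powr - \<beta>"
    proof (rule eventually_mono)
      fix k assume "\<omega> \<in> space M - E k"
      then have "X k \<omega> powr p < (real k powr - \<beta>) powr p"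
        by (auto simp: E_def powr_powr mult.commute)
      then show "X k \<omega> \<le> real k powr - \<beta>"
        using p powr_mono2[of p "real k powr - \<beta>" "X k \<omega>"] by (force simp: not_le)
    qed
  qed
qed

section \<open>Surface measure and spherical harmonics\<close>

text \<open>Finiteness makes Tonelli's theorem available for products with the surface measure.\<close>
lemma emeasure_surface_measure_finite:
  "emeasure surface_measure (space surface_measure) < (\<infinity>::ennreal)" 
proof -
  let ?R = "restrict_space lborel (ball 0 1 - {0::'a})"
  have sgn: "(sgn :: 'a \<Rightarrow> 'a) \<in> measurable ?R (restrict_space borel (sphere 0 1))"
  proof (rule measurable_restrict_space2)
    show "sgn \<in> space ?R \<rightarrow> sphere (0::'a) 1"
      by (auto simp: space_restrict_space norm_sgn)
    have "(\<lambda>x::'a. x /\<^sub>R norm x) \<in> borel_measurable borel" by measurable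
    then show "(sgn :: 'a \<Rightarrow> 'a) \<in> borel_measurable ?R"
      by (auto simp: sgn_div_norm[abs_def] intro: measurable_restrict_space1)
  qed
  let ?D = "distr ?R (restrict_space borel (sphere 0 1)) (sgn :: 'a \<Rightarrow> 'a)"
  have "emeasure ?D (space ?D) = emeasure ?R (space ?R)"
    using measurable_space[OF sgn] sets.top[of ?D]
    by (subst emeasure_distr[OF sgn]) (auto intro!: arg_cong2[where f=emeasure] simp del: sets.top)
  also have "\<dots> \<le> emeasure lborel (ball (0::'a) 1)"
    by (subst emeasure_restrict_space) (auto simp: space_restrict_space intro!: emeasure_mono)
  also have "\<dots> < \<infinity>"
    using emeasure_lborel_ball_finite by auto
  finally show ?thesis
    by (simp add: surface_measure_def space_scale_measure ennreal_mult_less_top of_nat_less_top)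
qed

lemma sets_surface_measure [measurable_cong]:
  "sets (surface_measure :: 'a::euclidean_space measure) = sets (restrict_space borel (sphere 0 1))"
  by (simp add: surface_measure_def)

lemma space_surface_measure: "space surface_measure = sphere 0 1"
  using sets_eq_imp_space_eq[OF sets_surface_measure] by (simp add: space_restrict_space)

interpretation surface: finite_measure "surface_measure :: 'a::euclidean_space measure"
  using emeasure_surface_measure_finite by (intro finite_measureI) (auto simp: less_top)

lemma spherical_harmonic_measurable:
  assumes "spherical_harmonic l (f :: 'a::euclidean_space \<Rightarrow> real)"
  shows "f \<in> borel_measurable surface_measure"
proof -
  obtain P where P: "real_polynomial_function P" "\<forall>x\<in>sphere 0 1. f x = P x"
    using assms by (auto simp: spherical_harmonic_def)
  have "continuous_on UNIV P"
    using P(1) continuous_real_polymonial_function by (auto intro: continuous_at_imp_continuous_on)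
  then have "P \<in> borel_measurable borel" by (rule borel_measurable_continuous_onI)
  then have "P \<in> borel_measurable surface_measure"
    by (subst measurable_cong_sets[OF sets_surface_measure refl]) (rule measurable_restrict_space1)
  then show ?thesis
    using P(2) by (subst measurable_cong[where g=P]) (auto simp: space_surface_measure)
qed

section \<open>Remainders of the Karhunen-Loeve expansion\<close>

text \<open>The multiplicity \<open>h\<close> is a parameter because its value depends on the type \<open>'a\<close> alone.\<close>
locale karhunen_loeve_field =
  fixes S :: "nat \<Rightarrow> nat \<Rightarrow> 'a::euclidean_space \<Rightarrow> real" and M :: "'w measure"
    and T :: "'w \<Rightarrow> 'a \<Rightarrow> real" and a :: "nat \<Rightarrow> nat \<Rightarrow> 'w \<Rightarrow> real" and A :: "nat \<Rightarrow> real"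
    and h :: "nat \<Rightarrow> nat"
  assumes h_def: "h = (\<lambda>l. harmonic_dim l DIM('a))"
    and harmonics: "orthonormal_harmonics S"
    and field: "gaussian_isotropic_field M T"
    and expansion: "karhunen_loeve S M T a A"
begin

sublocale prob_space M using field by (simp add: gaussian_isotropic_field_def)

sublocale harmonics: orthonormal_family surface_measure "SIGMA l:UNIV. {1..h l}" "\<lambda>(l, m). S l m"
proof
  fix i j assume ij: "i \<in> (SIGMA l:UNIV. {1..h l})" "j \<in> (SIGMA l:UNIV. {1..h l})"
  obtain l m l' m' where "i = (l, m)" "j = (l', m')" by (metis surj_pair)
  then show "(case i of (l, m) \<Rightarrow> S l m) \<in> borel_measurable surface_measure"
    and "(\<integral>x. (case i of (l, m) \<Rightarrow> S l m) x * (case j of (l, m) \<Rightarrow> S l m) x \<partial>surface_measure) =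
           (if i = j then 1 else 0)"
    using ij harmonics by (auto simp: orthonormal_harmonics_def h_def intro!: spherical_harmonic_measurable[of l])
qed

text \<open>The sum stops before degree \<open>k\<close>, so that the field itself is the remainder \<open>0\<close> and the error of
  the truncation at \<open>\<kappa>\<close> is the remainder \<open>Suc \<kappa>\<close>.\<close>
definition remainder :: "nat \<Rightarrow> 'w \<Rightarrow> 'a \<Rightarrow> real" where
  "remainder k \<omega> x = T \<omega> x - (\<Sum>l<k. \<Sum>m=1..h l. a l m \<omega> * S l m x)"

lemma remainder_0: "remainder 0 = T"
  by (simp add: remainder_def fun_eq_iff)

lemma remainder_Suc: "remainder (Suc \<kappa>) \<omega> = (\<lambda>x. T \<omega> x - truncated_field S a \<kappa> \<omega> x)"
  by (rule ext) (simp only: remainder_def truncated_field_def lessThan_Suc_atMost, simp only: h_def)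

definition energy :: "nat \<Rightarrow> 'w \<Rightarrow> real" where
  "energy l \<omega> = (\<Sum>m=1..h l. (a l m \<omega>)\<^sup>2)"

lemma energy_nonneg: "energy l \<omega> \<ge> 0"
  by (simp add: energy_def sum_nonneg)

lemma coefficient:
  assumes "m \<in> {1..h l}"
  shows "gaussian_rv M (a l m)" "(\<integral>\<omega>. a l m \<omega> \<partial>M) = 0" "(\<integral>\<omega>. (a l m \<omega>)\<^sup>2 \<partial>M) = A l"
  using expansion assms by (auto simp: karhunen_loeve_def h_def power2_eq_square)

lemma coefficient_measurable [measurable]: "m \<in> {1..h l} \<Longrightarrow> a l m \<in> borel_measurable M"
  using coefficient(1) by (auto simp: gaussian_rv_def)

lemma coefficient_square_integrable: "m \<in> {1..h l} \<Longrightarrow> integrable M (\<lambda>\<omega>. (a l m \<omega>)\<^sup>2)"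
  using centred_gaussian_even_moment(1)[OF coefficient(1,2), where n=1] by simp

lemma harmonic_measurable [measurable]: "m \<in> {1..h l} \<Longrightarrow> S l m \<in> borel_measurable surface_measure"
  using harmonics.basis_measurable[of "(l, m)"] by auto

lemma field_measurable [measurable]: "(\<lambda>(\<omega>, x). T \<omega> x) \<in> borel_measurable (M \<Otimes>\<^sub>M surface_measure)"
  using field unfolding gaussian_isotropic_field_def
  by (auto simp: measurable_cong_sets[OF sets_pair_measure_cong[OF refl sets_surface_measure] refl])

lemma expansion_measurable [measurable]:
  "(\<lambda>(\<omega>, x). \<Sum>l\<in>L. \<Sum>m=1..h l. a l m \<omega> * S l m x) \<in> borel_measurable (M \<Otimes>\<^sub>M surface_measure)"
  unfolding split_beta' by (intro borel_measurable_sum borel_measurable_times) auto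

lemma remainder_measurable [measurable]:
  "(\<lambda>(\<omega>, x). remainder k \<omega> x) \<in> borel_measurable (M \<Otimes>\<^sub>M surface_measure)"
  unfolding remainder_def split_beta'
  using borel_measurable_diff[OF field_measurable expansion_measurable[of "{..<k}"]]
  by (simp add: split_beta')

lemma L2_sphere_norm_measurable:
  assumes "(\<lambda>(\<omega>, x). X \<omega> x) \<in> borel_measurable (M \<Otimes>\<^sub>M surface_measure)"
  shows "(\<lambda>\<omega>. L2_sphere_norm (X \<omega>)) \<in> borel_measurable M"
proof -
  have "(\<lambda>\<omega>. \<integral>x. (X \<omega> x)\<^sup>2 \<partial>surface_measure) \<in> borel_measurable M"
    by (rule surface.borel_measurable_lebesgue_integral) (use assms in \<open>simp add: split_beta'\<close>)
  then show ?thesis by (simp add: L2_sphere_norm_def)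
qed

lemma mean_energy:
  shows "integrable M (energy l)" "(\<integral>\<omega>. energy l \<omega> \<partial>M) = real (h l) * A l"
  unfolding energy_def using coefficient_square_integrable coefficient(3) by auto

lemma sum_energy: "(\<Sum>i\<in>(SIGMA l:L. {1..h l}). ((case i of (l, m) \<Rightarrow> a l m \<omega>))\<^sup>2) = (\<Sum>l\<in>L. energy l \<omega>)"
  if "finite L"
  using that by (simp add: energy_def sum.Sigma split_beta')

text \<open>By Tonelli's theorem the mean over \<open>\<omega>\<close> of the squared errors tends to \<open>0\<close>, and by Fatou's lemma
  the lower limit of the squared errors has mean \<open>0\<close>. Parseval's identity then applies path by
  path.\<close>
lemma AE_parseval:
  "AE \<omega> in M. L2_sphere (T \<omega>) \<and>
     (\<forall>k. integrable surface_measure (\<lambda>x. (remainder k \<omega> x)\<^sup>2) \<and>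
       (\<lambda>l. energy (l + k) \<omega>) sums (L2_sphere_norm (remainder k \<omega>))\<^sup>2) \<and>
     (\<lambda>k. L2_sphere_norm (remainder k \<omega>)) \<longlonglongrightarrow> 0"
proof -
  let ?G = "\<lambda>k \<omega>. \<integral>\<^sup>+x. ennreal ((remainder k \<omega> x)\<^sup>2) \<partial>surface_measure"
  have tonelli: "(\<integral>\<^sup>+(\<omega>, x). ennreal ((remainder k \<omega> x)\<^sup>2) \<partial>(M \<Otimes>\<^sub>M surface_measure)) = (\<integral>\<^sup>+\<omega>. ?G k \<omega> \<partial>M)" for k
    by (subst surface.nn_integral_fst[symmetric]) (simp_all add: split_beta')
  have "(\<lambda>\<kappa>. \<integral>\<^sup>+\<omega>. ?G (Suc \<kappa>) \<omega> \<partial>M) \<longlonglongrightarrow> 0"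
    using expansion unfolding tonelli[symmetric] by (simp add: karhunen_loeve_def remainder_Suc)
  then have "(\<lambda>k. \<integral>\<^sup>+\<omega>. ?G k \<omega> \<partial>M) \<longlonglongrightarrow> 0"
    by (subst (asm) filterlim_sequentially_Suc)
  then have "liminf (\<lambda>k. \<integral>\<^sup>+\<omega>. ?G k \<omega> \<partial>M) = 0"
    by (rule lim_imp_Liminf[rotated]) simp
  moreover have meas [measurable]: "?G k \<in> borel_measurable M" for k
    by (intro surface.borel_measurable_nn_integral) (simp add: split_beta')
  ultimately have "(\<integral>\<^sup>+\<omega>. liminf (\<lambda>k. ?G k \<omega>) \<partial>M) = 0"
    using nn_integral_liminf[of ?G M] by simp
  then have "AE \<omega> in M. liminf (\<lambda>k. ?G k \<omega>) = 0"
    by (subst (asm) nn_integral_0_iff_AE) auto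
  then show ?thesis
  proof (rule AE_mp, intro AE_I2 impI)
    fix \<omega> assume \<omega>: "\<omega> \<in> space M" and lim: "liminf (\<lambda>k. ?G k \<omega>) = 0"
    define J where "J k = (SIGMA l:{..<k}. {1..h l})" for k
    have rem: "remainder k \<omega> x = T \<omega> x - (\<Sum>i\<in>J k. (case i of (l, m) \<Rightarrow> a l m \<omega>) * (case i of (l, m) \<Rightarrow> S l m) x)" for k x
      by (simp add: remainder_def J_def sum.Sigma split_beta')
    have J: "finite (J k)" "J k \<subseteq> (SIGMA l:UNIV. {1..h l})" "incseq J" for k
      by (auto simp: J_def incseq_def)
    have T_meas: "T \<omega> \<in> borel_measurable surface_measure"
      using measurable_Pair2[OF field_measurable \<omega>] by simp
    note P = harmonics.parseval_of_liminf[OF J T_meas, where c="\<lambda>(l, m). a l m \<omega>", folded rem, OF lim]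
    define F where "F = (\<integral>x. (T \<omega> x)\<^sup>2 \<partial>surface_measure)"
    have sq: "(L2_sphere_norm (remainder k \<omega>))\<^sup>2 = (\<integral>x. (remainder k \<omega> x)\<^sup>2 \<partial>surface_measure)" for k
      by (simp add: L2_sphere_norm_def)
    have r: "(L2_sphere_norm (remainder k \<omega>))\<^sup>2 = F - (\<Sum>l<k. energy l \<omega>)" for k
      unfolding sq P(2) F_def by (simp only: J_def sum_energy finite_lessThan)
    have "(\<lambda>k. (L2_sphere_norm (remainder k \<omega>))\<^sup>2) \<longlonglongrightarrow> 0"
      unfolding sq by (rule P(3))
    then have "(\<lambda>k. F - (L2_sphere_norm (remainder k \<omega>))\<^sup>2) \<longlonglongrightarrow> F - 0"
      by (intro tendsto_intros)
    then have "(\<lambda>l. energy l \<omega>) sums F"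
      by (simp add: sums_def r)
    then have "(\<lambda>l. energy (l + k) \<omega>) sums (L2_sphere_norm (remainder k \<omega>))\<^sup>2" for k
      unfolding r by (rule sums_split_initial_segment)
    moreover have "(\<lambda>k. L2_sphere_norm (remainder k \<omega>)) \<longlonglongrightarrow> 0"
      using tendsto_real_sqrt[OF P(3)] by (simp add: L2_sphere_norm_def)
    moreover have "integrable surface_measure (\<lambda>x. (remainder k \<omega> x)\<^sup>2)" for k
      using harmonics.subtract_expansion(1)[OF J(1,2) T_meas P(1), where c="\<lambda>(l, m). a l m \<omega>"] by (simp add: rem)
    ultimately show "L2_sphere (T \<omega>) \<and>
     (\<forall>k. integrable surface_measure (\<lambda>x. (remainder k \<omega> x)\<^sup>2) \<and>
       (\<lambda>l. energy (l + k) \<omega>) sums (L2_sphere_norm (remainder k \<omega>))\<^sup>2) \<and>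
     (\<lambda>k. L2_sphere_norm (remainder k \<omega>)) \<longlonglongrightarrow> 0"
      using P(1) T_meas by (auto simp: L2_sphere_def)
  qed
qed

lemma remainder_norm_measurable [measurable]:
  "(\<lambda>\<omega>. L2_sphere_norm (remainder k \<omega>)) \<in> borel_measurable M"
  by (rule L2_sphere_norm_measurable[OF remainder_measurable])

text \<open>The basic estimate: the error after degree \<open>k\<close> has the size of the square root of the tail of
  the spectrum, in every \<open>L\<^sup>p\<close>. The majorant \<open>t\<close> is chosen later: the given power of \<open>l\<close> for the
  rates, and a perturbation of the spectrum for mere convergence.\<close>
lemma remainder_moment:
  assumes t: "\<And>l. k \<le> l \<Longrightarrow> 0 < t l" "\<And>l. k \<le> l \<Longrightarrow> A l \<le> t l"
    and s: "0 < s" "\<And>n. (\<Sum>l\<in>{k..<n}. real (h l) * t l) \<le> s\<^sup>2"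
    and p: "1 \<le> p"
  shows "integrable M (\<lambda>\<omega>. L2_sphere_norm (remainder k \<omega>) powr p)"
    and "(\<integral>\<omega>. L2_sphere_norm (remainder k \<omega>) powr p \<partial>M) \<le> s powr p * (1 + gaussian_even_moment (nat \<lceil>p\<rceil>))"
proof -
  define n where "n = nat \<lceil>p\<rceil>"
  have n: "1 \<le> n" "p \<le> 2 * real n" using p by (simp_all add: n_def) linarith+
  have part: "(\<integral>\<^sup>+\<omega>. ennreal ((\<Sum>l\<in>{k..<j}. energy l \<omega>) ^ n) \<partial>M)
      \<le> ennreal (gaussian_even_moment n * s ^ (2 * n))" for j
  proof -
    have "(\<integral>\<^sup>+\<omega>. ennreal ((\<Sum>i\<in>(SIGMA l:{k..<j}. {1..h l}). (a (fst i) (snd i) \<omega>)\<^sup>2) ^ n) \<partial>M)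
        \<le> ennreal (gaussian_even_moment n * (s\<^sup>2) ^ n)"
    proof (rule moment_sum_squares_le[where t="\<lambda>i. t (fst i)"])
      show "(\<Sum>i\<in>(SIGMA l:{k..<j}. {1..h l}). t (fst i)) \<le> s\<^sup>2"
        using s(2)[of j] sum.Sigma[of "{k..<j}" "\<lambda>l. {1..h l}" "\<lambda>l m. t l"] by (simp add: split_beta')
    qed (use t n coefficient in auto)
    then show ?thesis
      by (simp add: energy_def sum.Sigma split_beta' power_mult)
  qed
  have "(\<integral>\<^sup>+\<omega>. ennreal (L2_sphere_norm (remainder k \<omega>) ^ (2 * n)) \<partial>M)
      \<le> (\<integral>\<^sup>+\<omega>. liminf (\<lambda>j. ennreal ((\<Sum>l\<in>{k..<j}. energy l \<omega>) ^ n)) \<partial>M)"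
  proof (rule nn_integral_mono_AE)
    show "AE \<omega> in M. ennreal (L2_sphere_norm (remainder k \<omega>) ^ (2 * n))
        \<le> liminf (\<lambda>j. ennreal ((\<Sum>l\<in>{k..<j}. energy l \<omega>) ^ n))"
      using AE_parseval
    proof (rule AE_mp, intro AE_I2 impI)
      fix \<omega> assume "L2_sphere (T \<omega>) \<and>
        (\<forall>k. integrable surface_measure (\<lambda>x. (remainder k \<omega> x)\<^sup>2) \<and>
          (\<lambda>l. energy (l + k) \<omega>) sums (L2_sphere_norm (remainder k \<omega>))\<^sup>2) \<and>
        (\<lambda>k. L2_sphere_norm (remainder k \<omega>)) \<longlonglongrightarrow> 0"
      then have "(\<lambda>j. \<Sum>l<j. energy (l + k) \<omega>) \<longlonglongrightarrow> (L2_sphere_norm (remainder k \<omega>))\<^sup>2"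
        by (simp add: sums_def)
      also have "(\<lambda>j. \<Sum>l<j. energy (l + k) \<omega>) = (\<lambda>j. \<Sum>l\<in>{k..<j + k}. energy l \<omega>)"
        using sum.shift_bounds_nat_ivl[of "\<lambda>l. energy l \<omega>" 0 k] by (simp add: lessThan_atLeast0)
      finally have "(\<lambda>j. \<Sum>l\<in>{k..<j}. energy l \<omega>) \<longlonglongrightarrow> (L2_sphere_norm (remainder k \<omega>))\<^sup>2"
        by (rule LIMSEQ_offset)
      then have "(\<lambda>j. ennreal ((\<Sum>l\<in>{k..<j}. energy l \<omega>) ^ n))
          \<longlonglongrightarrow> ennreal (((L2_sphere_norm (remainder k \<omega>))\<^sup>2) ^ n)"
        by (intro tendsto_ennrealI tendsto_power)
      then show "ennreal (L2_sphere_norm (remainder k \<omega>) ^ (2 * n))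
        \<le> liminf (\<lambda>j. ennreal ((\<Sum>l\<in>{k..<j}. energy l \<omega>) ^ n))"
        by (simp add: lim_imp_Liminf power_mult)
    qed
  qed
  also have "\<dots> \<le> liminf (\<lambda>j. \<integral>\<^sup>+\<omega>. ennreal ((\<Sum>l\<in>{k..<j}. energy l \<omega>) ^ n) \<partial>M)"
    using mean_energy(1) by (intro nn_integral_liminf) (auto dest: borel_measurable_integrable)
  also have "\<dots> \<le> ennreal (gaussian_even_moment n * s ^ (2 * n))"
    using part by (intro Liminf_le) (auto intro!: always_eventually)
  finally have mom: "(\<integral>\<^sup>+\<omega>. ennreal (L2_sphere_norm (remainder k \<omega>) ^ (2 * n)) \<partial>M)
      \<le> ennreal (gaussian_even_moment n * s ^ (2 * n))" .
  have nn: "0 \<le> L2_sphere_norm (remainder k \<omega>)" for \<omega> by (simp add: L2_sphere_norm_def)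
  show "integrable M (\<lambda>\<omega>. L2_sphere_norm (remainder k \<omega>) powr p)"
    and "(\<integral>\<omega>. L2_sphere_norm (remainder k \<omega>) powr p \<partial>M) \<le> s powr p * (1 + gaussian_even_moment (nat \<lceil>p\<rceil>))"
    using integral_powr_le_of_even_moment[OF prob_space_axioms remainder_norm_measurable nn p n(2) s(1) _ mom]
      gaussian_even_moment_pos[of n] by (simp_all add: n_def less_imp_le)
qed

lemma remainder_Lp_norm:
  assumes t: "\<And>l. k \<le> l \<Longrightarrow> 0 < t l" "\<And>l. k \<le> l \<Longrightarrow> A l \<le> t l"
    and s: "0 < s" "\<And>n. (\<Sum>l\<in>{k..<n}. real (h l) * t l) \<le> s\<^sup>2"
    and p: "1 \<le> p"
  shows "Lp_L2_norm p M (remainder k) \<le> s * (1 + gaussian_even_moment (nat \<lceil>p\<rceil>)) powr (1 / p)"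
proof -
  have "Lp_L2_norm p M (remainder k) \<le> (s powr p * (1 + gaussian_even_moment (nat \<lceil>p\<rceil>))) powr (1 / p)"
    unfolding Lp_L2_norm_def using p
    by (intro powr_mono2 remainder_moment(2)[OF t s p]) auto
  also have "\<dots> = s * (1 + gaussian_even_moment (nat \<lceil>p\<rceil>)) powr (1 / p)"
    using s(1) p gaussian_even_moment_pos[of "nat \<lceil>p\<rceil>"] by (simp add: powr_mult powr_powr)
  finally show ?thesis .
qed

lemma spectrum_nonneg: "0 \<le> real (h l) * A l"
  unfolding mean_energy(2)[symmetric] by (intro integral_nonneg_AE AE_I2 energy_nonneg)

text \<open>Some remainder has a second moment below \<open>1\<close>, and by Parseval's identity this moment dominates
  all partial sums of the tail of the spectrum.\<close>
lemma summable_spectrum: "summable (\<lambda>l. real (h l) * A l)"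
proof -
  have "(\<lambda>\<kappa>. \<integral>\<^sup>+(\<omega>, x). ennreal ((remainder (Suc \<kappa>) \<omega> x)\<^sup>2) \<partial>(M \<Otimes>\<^sub>M surface_measure)) \<longlonglongrightarrow> 0"
    using expansion by (simp add: karhunen_loeve_def remainder_Suc)
  then have "\<forall>\<^sub>F \<kappa> in sequentially.
      (\<integral>\<^sup>+(\<omega>, x). ennreal ((remainder (Suc \<kappa>) \<omega> x)\<^sup>2) \<partial>(M \<Otimes>\<^sub>M surface_measure)) < 1"
    by (rule order_tendstoD(2)) simp
  then obtain \<kappa> where \<kappa>: "(\<integral>\<^sup>+(\<omega>, x). ennreal ((remainder (Suc \<kappa>) \<omega> x)\<^sup>2) \<partial>(M \<Otimes>\<^sub>M surface_measure)) < 1"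
    by (auto simp: eventually_sequentially)
  define k where "k = Suc \<kappa>"
  have k: "(\<integral>\<^sup>+\<omega>. \<integral>\<^sup>+x. ennreal ((remainder k \<omega> x)\<^sup>2) \<partial>surface_measure \<partial>M) < 1"
    using \<kappa> unfolding k_def by (subst (asm) surface.nn_integral_fst[symmetric]) (simp_all add: split_beta')
  have "(\<Sum>l<n. real (h (l + k)) * A (l + k)) \<le> 1" for n
  proof -
    have "ennreal (\<Sum>l<n. real (h (l + k)) * A (l + k)) = ennreal (\<integral>\<omega>. (\<Sum>l<n. energy (l + k) \<omega>) \<partial>M)"
      using mean_energy by simp
    also have "\<dots> = (\<integral>\<^sup>+\<omega>. ennreal (\<Sum>l<n. energy (l + k) \<omega>) \<partial>M)"
      using mean_energy(1) by (intro nn_integral_eq_integral[symmetric]) (auto intro!: sum_nonneg energy_nonneg)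
    also have "\<dots> \<le> (\<integral>\<^sup>+\<omega>. \<integral>\<^sup>+x. ennreal ((remainder k \<omega> x)\<^sup>2) \<partial>surface_measure \<partial>M)"
    proof (rule nn_integral_mono_AE)
      show "AE \<omega> in M. ennreal (\<Sum>l<n. energy (l + k) \<omega>)
          \<le> (\<integral>\<^sup>+x. ennreal ((remainder k \<omega> x)\<^sup>2) \<partial>surface_measure)"
        using AE_parseval
      proof eventually_elim
        case (elim \<omega>)
        then have int: "integrable surface_measure (\<lambda>x. (remainder k \<omega> x)\<^sup>2)"
          and sums: "(\<lambda>l. energy (l + k) \<omega>) sums (\<integral>x. (remainder k \<omega> x)\<^sup>2 \<partial>surface_measure)"
          by (auto simp: L2_sphere_norm_def)
        show ?case
          unfolding nn_integral_eq_integral[OF int AE_I2[OF zero_le_power2]] sums_unique[OF sums]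
          using sums by (intro ennreal_leI sum_le_suminf) (auto intro: energy_nonneg sums_summable)
      qed
    qed
    also have "\<dots> \<le> ennreal 1" using k by simp
    finally show ?thesis by (subst (asm) ennreal_le_iff) auto
  qed
  then have "summable (\<lambda>l. real (h (l + k)) * A (l + k))"
    by (intro summableI_nonneg_bounded[where x=1] spectrum_nonneg)
  then show ?thesis by (subst (asm) summable_iff_shift)
qed

text \<open>Convergence without a rate. The spectrum may vanish at some degrees, and the geometric sequence
  added to it here makes the majorant positive while keeping it summable.\<close>
lemma spectral_tail_bound:
  obtains s where "\<And>k. 0 < s k" "s \<longlonglongrightarrow> 0"
    "\<And>k p. 1 \<le> p \<Longrightarrow> integrable M (\<lambda>\<omega>. L2_sphere_norm (remainder k \<omega>) powr p)"
    "\<And>k p. 1 \<le> p \<Longrightarrow>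
       Lp_L2_norm p M (remainder k) \<le> s k * (1 + gaussian_even_moment (nat \<lceil>p\<rceil>)) powr (1 / p)"
proof
  define v where "v l = real (h l) * A l + (1 / 2) ^ l" for l
  \<comment> \<open>The absolute value covers degrees with \<open>h l = 0\<close>, where the sign of \<open>A l\<close> is undetermined.\<close>
  define t where "t l = \<bar>A l\<bar> + (1 / 2) ^ l / (real (h l) + 1)" for l
  define s where "s k = sqrt (\<Sum>l. v (l + k))" for k
  have v_pos: "0 < v l" for l
    unfolding v_def by (intro add_nonneg_pos spectrum_nonneg) simp
  have v_sum: "summable (\<lambda>l. v (l + k))" for k
    unfolding v_def using summable_spectrum by (intro summable_ignore_initial_segment summable_add summable_geometric) auto
  show s_pos: "0 < s k" for k
    unfolding s_def real_sqrt_gt_0_iff by (intro suminf_pos v_sum v_pos)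
  have "(\<lambda>k. \<Sum>l. v (l + k)) \<longlonglongrightarrow> 0"
    using suminf_exist_split2[of v] v_sum[of 0] by simp
  then show "s \<longlonglongrightarrow> 0"
    unfolding s_def using tendsto_real_sqrt[of _ 0] by simp
  have ht: "real (h l) * t l \<le> v l" for l
  proof -
    have "real (h l) * \<bar>A l\<bar> = real (h l) * A l"
      using spectrum_nonneg[of l] by (auto simp: abs_if zero_le_mult_iff)
    moreover have "(1 / 2) ^ l * (real (h l) / (real (h l) + 1)) \<le> (1 / 2 :: real) ^ l * 1"
      by (intro mult_left_mono) (auto simp: divide_le_eq)
    moreover have "real (h l) * t l = real (h l) * \<bar>A l\<bar> + (1 / 2) ^ l * (real (h l) / (real (h l) + 1))"
      unfolding t_def by (simp add: distrib_left)
    ultimately show ?thesis unfolding v_def mult_1_right by linarith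
  qed
  have "(\<Sum>l\<in>{k..<n}. real (h l) * t l) \<le> (s k)\<^sup>2" for k n
  proof -
    have "(\<Sum>l\<in>{k..<n}. real (h l) * t l) \<le> (\<Sum>l\<in>{k..<n}. v l)"
      by (intro sum_mono ht)
    also have "\<dots> = (\<Sum>l<n - k. v (l + k))"
      by (rule sum.reindex_bij_witness[of _ "\<lambda>l. l + k" "\<lambda>l. l - k"]) auto
    also have "\<dots> \<le> (\<Sum>l. v (l + k))"
      using v_sum v_pos by (intro sum_le_suminf) (auto intro: less_imp_le)
    also have "\<dots> = (s k)\<^sup>2"
      using s_pos[of k] unfolding s_def by (simp add: less_imp_le)
    finally show ?thesis .
  qed
  moreover have "0 < t l" "A l \<le> t l" for l
    by (auto simp: t_def add_nonneg_pos add_increasing2)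
  ultimately show "1 \<le> p \<Longrightarrow> integrable M (\<lambda>\<omega>. L2_sphere_norm (remainder k \<omega>) powr p)"
    and "1 \<le> p \<Longrightarrow> Lp_L2_norm p M (remainder k) \<le> s k * (1 + gaussian_even_moment (nat \<lceil>p\<rceil>)) powr (1 / p)" for k p
    using remainder_moment(1)[of k t "s k" p] remainder_Lp_norm[of k t "s k" p] s_pos by blast+
qed

lemma field_in_Lp_L2:
  assumes "1 \<le> p" shows "Lp_L2 p M T"
proof -
  have "integrable M (\<lambda>\<omega>. L2_sphere_norm (T \<omega>) powr p)"
    using spectral_tail_bound assms by (metis remainder_0)
  moreover have "AE \<omega> in M. L2_sphere (T \<omega>)"
    using AE_parseval by eventually_elim simp
  ultimately show ?thesis by (simp add: Lp_L2_def)
qed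

text \<open>By Parseval's identity a truncation has almost surely at most the norm of the field.\<close>
lemma truncation_in_Lp_L2:
  assumes p: "1 \<le> p" shows "Lp_L2 p M (truncated_field S a \<kappa>)"
proof -
  have meas: "(\<lambda>(\<omega>, x). truncated_field S a \<kappa> \<omega> x) \<in> borel_measurable (M \<Otimes>\<^sub>M surface_measure)"
    using expansion_measurable[of "{..\<kappa>}"] by (simp add: truncated_field_def h_def)
  let ?J = "SIGMA l:{..\<kappa>}. {1..h l}"
  have trunc: "truncated_field S a \<kappa> \<omega> x =
      (\<Sum>i\<in>?J. (case i of (l, m) \<Rightarrow> a l m \<omega>) * (case i of (l, m) \<Rightarrow> S l m) x)" for \<omega> x
    by (simp add: truncated_field_def sum.Sigma split_beta' h_def)
  have J: "finite ?J" "?J \<subseteq> (SIGMA l:UNIV. {1..h l})" by auto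
  note E = harmonics.finite_expansion[OF J, where c="\<lambda>(l, m). a l m \<omega>" for \<omega>, folded trunc]
  have L2: "L2_sphere (truncated_field S a \<kappa> \<omega>)" if "\<omega> \<in> space M" for \<omega>
    using measurable_Pair2[OF meas that] E(1)[of \<omega>] by (simp add: L2_sphere_def)
  have norm: "L2_sphere_norm (truncated_field S a \<kappa> \<omega>) = sqrt (\<Sum>l\<le>\<kappa>. energy l \<omega>)" for \<omega>
    unfolding L2_sphere_norm_def E(2) by (simp only: sum_energy finite_atMost)
  have "AE \<omega> in M. L2_sphere_norm (truncated_field S a \<kappa> \<omega>) \<le> L2_sphere_norm (T \<omega>)"
    using AE_parseval
  proof eventually_elim
    case (elim \<omega>)
    then have sums: "(\<lambda>l. energy l \<omega>) sums (L2_sphere_norm (T \<omega>))\<^sup>2"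
      by (auto simp: remainder_0 dest: spec[of _ 0])
    then have "(\<Sum>l\<le>\<kappa>. energy l \<omega>) \<le> (L2_sphere_norm (T \<omega>))\<^sup>2"
      unfolding sums_unique[OF sums] by (intro sum_le_suminf) (auto intro: energy_nonneg sums_summable)
    then show ?case
      unfolding norm by (intro real_le_lsqrt) (auto simp: L2_sphere_norm_def sum_nonneg energy_nonneg)
  qed
  then have dom: "AE \<omega> in M. norm (L2_sphere_norm (truncated_field S a \<kappa> \<omega>) powr p) \<le> norm (L2_sphere_norm (T \<omega>) powr p)"
    by eventually_elim (use p in \<open>auto intro!: powr_mono2 simp: L2_sphere_norm_def\<close>)
  have [measurable]: "(\<lambda>\<omega>. L2_sphere_norm (truncated_field S a \<kappa> \<omega>)) \<in> borel_measurable M"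
    by (rule L2_sphere_norm_measurable[OF meas])
  have "integrable M (\<lambda>\<omega>. L2_sphere_norm (T \<omega>) powr p)"
    using field_in_Lp_L2[OF p] by (simp add: Lp_L2_def)
  then have "integrable M (\<lambda>\<omega>. L2_sphere_norm (truncated_field S a \<kappa> \<omega>) powr p)"
    by (rule Bochner_Integration.integrable_bound[OF _ _ dom]) measurable
  then show ?thesis using meas L2 by (auto simp: Lp_L2_def)
qed

lemma remainder_Lp_norm_tendsto_0:
  assumes "1 \<le> p" shows "(\<lambda>k. Lp_L2_norm p M (remainder k)) \<longlonglongrightarrow> 0"
proof -
  obtain s where s: "s \<longlonglongrightarrow> 0"
    and bound: "\<And>k. Lp_L2_norm p M (remainder k) \<le> s k * (1 + gaussian_even_moment (nat \<lceil>p\<rceil>)) powr (1 / p)"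
    using spectral_tail_bound assms by metis
  show ?thesis
    by (rule tendsto_sandwich[OF _ _ tendsto_const tendsto_mult_left_zero[OF s, of "(1 + gaussian_even_moment (nat \<lceil>p\<rceil>)) powr (1 / p)"]])
      (use bound in \<open>auto simp: Lp_L2_norm_def\<close>)
qed

section \<open>Decay of the spectrum and convergence rates\<close>

lemma spectral_tail_le:
  assumes d: "2 \<le> DIM('a)" and \<alpha>: "real DIM('a) - 1 < \<alpha>" and C: "0 < C" and \<kappa>: "1 \<le> \<kappa>"
  shows "(\<Sum>l\<in>{Suc \<kappa>..<n}. real (h l) * (C * real l powr - \<alpha>))
    \<le> (sqrt (rate_constant DIM('a) \<alpha>) * sqrt C * real \<kappa> powr - ((\<alpha> + 1 - real DIM('a)) / 2))\<^sup>2"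
proof -
  define d where "d = DIM('a)"
  define \<gamma> where "\<gamma> = \<alpha> + 2 - real d"
  have \<gamma>: "1 < \<gamma>" using \<alpha> by (simp add: \<gamma>_def d_def)
  have degree_le: "real (h l) * (C * real l powr - \<alpha>) \<le> 2 * real d ^ (d - 2) * C * real l powr - \<gamma>" if "1 \<le> l" for l
  proof -
    have "real (h l) \<le> 2 * (real l * real d) ^ (d - 2)"
      using harmonic_dim_le[OF d that] of_nat_mono[of "h l" "2 * (l * d) ^ (d - 2)", where 'a=real]
      by (simp add: h_def d_def)
    also have "\<dots> = 2 * real d ^ (d - 2) * real l powr (real d - 2)"
      using that d by (simp add: power_mult_distrib powr_realpow[symmetric] of_nat_diff d_def)
    finally have "real (h l) * (C * real l powr - \<alpha>)
        \<le> 2 * real d ^ (d - 2) * real l powr (real d - 2) * (C * real l powr - \<alpha>)"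
      using C by (intro mult_right_mono) auto
    also have "\<dots> = 2 * real d ^ (d - 2) * C * real l powr ((real d - 2) + - \<alpha>)"
      by (simp only: powr_add mult_ac)
    finally show ?thesis by (simp add: \<gamma>_def algebra_simps)
  qed
  have "(\<Sum>l\<in>{Suc \<kappa>..<n}. real (h l) * (C * real l powr - \<alpha>))
      \<le> (\<Sum>l\<in>{\<kappa><..<n}. 2 * real d ^ (d - 2) * C * real l powr - \<gamma>)"
    unfolding atLeastSucLessThan_greaterThanLessThan using \<kappa> by (intro sum_mono degree_le) auto
  also have "\<dots> \<le> 2 * real d ^ (d - 2) * C * (real \<kappa> powr (1 - \<gamma>) / (\<gamma> - 1))"
    unfolding sum_distrib_left[symmetric] using C
    by (intro mult_left_mono sum_powr_tail_le[OF \<gamma> \<kappa>]) auto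
  also have "\<dots> = rate_constant d \<alpha> * C * real \<kappa> powr (1 - \<gamma>)"
    by (simp add: rate_constant_def \<gamma>_def algebra_simps)
  also have "\<dots> = (sqrt (rate_constant d \<alpha>) * sqrt C * real \<kappa> powr - ((\<alpha> + 1 - real d) / 2))\<^sup>2"
  proof -
    have "(real \<kappa> powr - ((\<alpha> + 1 - real d) / 2))\<^sup>2 = real \<kappa> powr (1 - \<gamma>)"
      unfolding power2_eq_square powr_add[symmetric]
      by (rule arg_cong[where f="\<lambda>y. real \<kappa> powr y"]) (simp add: \<gamma>_def)
    moreover have "0 \<le> rate_constant d \<alpha>" using \<alpha> by (simp add: rate_constant_def d_def)
    ultimately show ?thesis using C by (simp add: power_mult_distrib)
  qed
  finally show ?thesis by (simp add: d_def)
qed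

text \<open>If \<open>\<alpha> \<le> d - 1\<close>, then \<open>\<beta> < 0\<close> and the bound is at least \<open>1\<close>, so that convergence to \<open>0\<close> suffices.
  Otherwise the rate is lost only by passing from moments to almost every path, and arbitrarily
  little of it for large \<open>p\<close>.\<close>
lemma AE_remainder_rate:
  assumes d: "2 \<le> DIM('a)" and C: "0 < C" and l0: "1 \<le> l0"
    and decay: "\<And>l. l0 < l \<Longrightarrow> A l \<le> C * real l powr - \<alpha>"
    and \<beta>: "\<beta> < (\<alpha> + 1 - real DIM('a)) / 2"
  shows "AE \<omega> in M. \<forall>\<^sub>F \<kappa> in sequentially. L2_sphere_norm (remainder (Suc \<kappa>) \<omega>) \<le> real \<kappa> powr - \<beta>"
proof (cases "real DIM('a) - 1 < \<alpha>")
  case True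
  define \<beta>' where "\<beta>' = (\<alpha> + 1 - real DIM('a)) / 2"
  \<comment> \<open>Any \<open>p \<ge> 1\<close> with \<open>p (\<beta>' - \<beta>) > 1\<close> makes the exceedance probabilities summable.\<close>
  define p where "p = max 1 (2 / (\<beta>' - \<beta>))"
  define D where "D = sqrt (rate_constant DIM('a) \<alpha>) * sqrt C"
  have p1: "1 \<le> p" by (simp add: p_def)
  have D: "0 < D" using C rate_constant_pos[OF DIM_positive True] by (simp add: D_def)
  have gap: "0 < \<beta>' - \<beta>" using \<beta> by (simp add: \<beta>'_def)
  have "2 / (\<beta>' - \<beta>) \<le> p" by (simp add: p_def)
  then have "2 \<le> p * (\<beta>' - \<beta>)" by (simp only: pos_divide_le_eq[OF gap])
  then have p2: "1 < p * (\<beta>' - \<beta>)" by linarith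
  show ?thesis
  proof (rule AE_eventually_le_powr[OF prob_space_axioms, where p=p and \<beta>'=\<beta>' and N=l0
        and c="D powr p * (1 + gaussian_even_moment (nat \<lceil>p\<rceil>))"])
    show "integrable M (\<lambda>\<omega>. L2_sphere_norm (remainder (Suc k) \<omega>) powr p)" for k
      using spectral_tail_bound p1 by metis
    fix k assume k: "l0 \<le> k"
    have "(\<integral>\<omega>. L2_sphere_norm (remainder (Suc k) \<omega>) powr p \<partial>M)
        \<le> (D * real k powr - \<beta>') powr p * (1 + gaussian_even_moment (nat \<lceil>p\<rceil>))"
    proof (rule remainder_moment(2)[OF _ _ _ _ p1])
      show "(\<Sum>l\<in>{Suc k..<n}. real (h l) * (C * real l powr - \<alpha>)) \<le> (D * real k powr - \<beta>')\<^sup>2" for n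
        using spectral_tail_le[OF d True C, of k n] k l0 by (simp add: D_def \<beta>'_def)
    qed (use C D decay k l0 in auto)
    also have "\<dots> = D powr p * (1 + gaussian_even_moment (nat \<lceil>p\<rceil>)) * real k powr - (p * \<beta>')"
      using D by (simp add: powr_mult powr_powr mult_ac)
    finally show "(\<integral>\<omega>. L2_sphere_norm (remainder (Suc k) \<omega>) powr p \<partial>M)
        \<le> D powr p * (1 + gaussian_even_moment (nat \<lceil>p\<rceil>)) * real k powr - (p * \<beta>')" .
  qed (use p1 p2 in \<open>auto simp: L2_sphere_norm_def[of "remainder _ _"] remainder_norm_measurable[unfolded L2_sphere_norm_def]\<close>)
next
  case False
  show ?thesis
    using AE_parseval
  proof eventually_elim
    case (elim \<omega>)
    then have "\<forall>\<^sub>F k in sequentially. L2_sphere_norm (remainder k \<omega>) < 1"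
      by (intro order_tendstoD(2)) auto
    then have "\<forall>\<^sub>F \<kappa> in sequentially. L2_sphere_norm (remainder (Suc \<kappa>) \<omega>) < 1"
      by (subst eventually_sequentially_Suc)
    then show ?case
      using eventually_ge_at_top[of 1]
    proof eventually_elim
      case (elim \<kappa>)
      have "1 \<le> real \<kappa> powr - \<beta>"
        using elim(2) \<beta> False by (intro ge_one_powr_ge_zero) auto
      then show ?case using elim(1) by simp
    qed
  qed
qed

lemma remainder_Lp_rate:
  assumes d: "2 \<le> DIM('a)" and \<alpha>: "real DIM('a) - 1 < \<alpha>" and C: "0 < C" and l0: "1 \<le> l0"
    and decay: "\<And>l. l0 < l \<Longrightarrow> A l \<le> C * real l powr - \<alpha>" and p: "1 \<le> p" and \<kappa>: "l0 \<le> \<kappa>"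
  shows "Lp_L2_norm p M (remainder (Suc \<kappa>)) \<le>
    (sqrt (rate_constant DIM('a) \<alpha>) * (1 + gaussian_even_moment (nat \<lceil>p\<rceil>)) powr (1 / p)) * sqrt C *
      real \<kappa> powr - ((\<alpha> + 1 - real DIM('a)) / 2)"
proof -
  have "1 \<le> \<kappa>" using \<kappa> l0 by simp
  have "Lp_L2_norm p M (remainder (Suc \<kappa>)) \<le>
     (sqrt (rate_constant DIM('a) \<alpha>) * sqrt C * real \<kappa> powr - ((\<alpha> + 1 - real DIM('a)) / 2)) *
       (1 + gaussian_even_moment (nat \<lceil>p\<rceil>)) powr (1 / p)"
    by (rule remainder_Lp_norm[OF _ _ _ spectral_tail_le[OF d \<alpha> C \<open>1 \<le> \<kappa>\<close>] p])
      (use C decay \<kappa> \<open>1 \<le> \<kappa>\<close> rate_constant_pos[OF DIM_positive \<alpha>] in auto)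
  then show ?thesis by (simp only: mult_ac)
qed

lemma remainder_Lp_norm_bounded:
  assumes "1 \<le> p"
  obtains B where "0 < B" "\<And>k. Lp_L2_norm p M (remainder k) \<le> B"
proof -
  have "Bseq (\<lambda>k. Lp_L2_norm p M (remainder k))"
    by (rule convergent_imp_Bseq[OF convergentI[OF remainder_Lp_norm_tendsto_0[OF assms]]])
  then obtain B where "0 < B" "\<And>k. norm (Lp_L2_norm p M (remainder k)) \<le> B"
    by (auto elim: BseqE)
  then show ?thesis by (intro that[of B]) (auto dest: abs_le_D1)
qed

end

theorem theorem5p5:
  fixes \<alpha> :: real
  assumes "DIM('a::euclidean_space) \<ge> 2" and "\<alpha> > 2"
  shows "\<exists>K :: real \<Rightarrow> real. (\<forall>p\<ge>1. K p > 0) \<and>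
    (\<forall>(M :: 'w measure) (T :: 'w \<Rightarrow> 'a \<Rightarrow> real) S a A C (l0 :: nat).
       orthonormal_harmonics S \<and> gaussian_isotropic_field M T \<and> karhunen_loeve S M T a A \<and>
       C > 0 \<and> l0 \<ge> 1 \<and> (\<forall>l>l0. A l \<le> C * real l powr (- \<alpha>)) \<longrightarrow>
       (\<forall>p\<ge>1.
          Lp_L2 p M T \<and> (\<forall>\<kappa>. Lp_L2 p M (truncated_field S a \<kappa>)) \<and>
          (\<lambda>\<kappa>. Lp_L2_norm p M (\<lambda>\<omega> x. T \<omega> x - truncated_field S a \<kappa> \<omega> x)) \<longlonglongrightarrow> 0 \<and>
          (\<exists>Cp>0. (\<alpha> > real DIM('a) - 1 \<longrightarrow> Cp = K p * sqrt C) \<and>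
             (\<forall>\<kappa>\<ge>l0. Lp_L2_norm p M (\<lambda>\<omega> x. T \<omega> x - truncated_field S a \<kappa> \<omega> x)
                \<le> Cp * real \<kappa> powr (- ((\<alpha> + 1 - real DIM('a)) / 2))))) \<and>
       (AE \<omega> in M. L2_sphere (T \<omega>) \<and>
          (\<lambda>\<kappa>. L2_sphere_norm (\<lambda>x. T \<omega> x - truncated_field S a \<kappa> \<omega> x)) \<longlonglongrightarrow> 0) \<and>
       (\<forall>\<beta> < (\<alpha> + 1 - real DIM('a)) / 2. AE \<omega> in M. \<forall>\<^sub>F \<kappa> in sequentially.
          L2_sphere_norm (\<lambda>x. T \<omega> x - truncated_field S a \<kappa> \<omega> x) \<le> real \<kappa> powr (- \<beta>)))"
proof -
  let ?d = "real DIM('a)"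
  \<comment> \<open>For \<open>\<alpha> \<le> d - 1\<close> the rate constant is not positive, and \<open>K\<close> is given another positive value.\<close>
  define K where "K p = (if ?d - 1 < \<alpha> then sqrt (rate_constant DIM('a) \<alpha>) else 1) *
    (1 + gaussian_even_moment (nat \<lceil>p\<rceil>)) powr (1 / p)" for p
  have K_pos: "0 < K p" for p
    using gaussian_even_moment_pos[of "nat \<lceil>p\<rceil>"] by (auto simp: K_def rate_constant_def)
  show ?thesis
  proof (intro exI[of _ K] conjI allI impI)
    show "0 < K p" for p by (rule K_pos)
  next
    fix M :: "'w measure" and T :: "'w \<Rightarrow> 'a \<Rightarrow> real" and S a A C and l0 :: nat
    assume asm: "orthonormal_harmonics S \<and> gaussian_isotropic_field M T \<and> karhunen_loeve S M T a A \<and>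
       C > 0 \<and> l0 \<ge> 1 \<and> (\<forall>l>l0. A l \<le> C * real l powr (- \<alpha>))"
    interpret karhunen_loeve_field S M T a A "\<lambda>l. harmonic_dim l DIM('a)"
      using asm by unfold_locales auto
    have C: "0 < C" and l0: "1 \<le> l0" and decay: "\<And>l. l0 < l \<Longrightarrow> A l \<le> C * real l powr - \<alpha>"
      using asm by auto
    have error: "(\<lambda>\<omega> x. T \<omega> x - truncated_field S a \<kappa> \<omega> x) = remainder (Suc \<kappa>)" for \<kappa>
      using remainder_Suc by (simp add: fun_eq_iff)
    show "AE \<omega> in M. L2_sphere (T \<omega>) \<and>
          (\<lambda>\<kappa>. L2_sphere_norm (\<lambda>x. T \<omega> x - truncated_field S a \<kappa> \<omega> x)) \<longlonglongrightarrow> 0"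
      using AE_parseval unfolding remainder_Suc[symmetric]
    proof eventually_elim
      case (elim \<omega>)
      then show ?case using LIMSEQ_Suc[of "\<lambda>k. L2_sphere_norm (remainder k \<omega>)" 0] by blast
    qed
    show "AE \<omega> in M. \<forall>\<^sub>F \<kappa> in sequentially.
          L2_sphere_norm (\<lambda>x. T \<omega> x - truncated_field S a \<kappa> \<omega> x) \<le> real \<kappa> powr (- \<beta>)"
      if "\<beta> < (\<alpha> + 1 - ?d) / 2" for \<beta>
      unfolding remainder_Suc[symmetric] by (rule AE_remainder_rate[OF assms(1) C l0 decay that])
    fix p :: real assume p: "1 \<le> p"
    show "Lp_L2 p M T" by (rule field_in_Lp_L2[OF p])
    show "Lp_L2 p M (truncated_field S a \<kappa>)" for \<kappa> by (rule truncation_in_Lp_L2[OF p])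
    show "(\<lambda>\<kappa>. Lp_L2_norm p M (\<lambda>\<omega> x. T \<omega> x - truncated_field S a \<kappa> \<omega> x)) \<longlonglongrightarrow> 0"
      unfolding error by (rule LIMSEQ_Suc[OF remainder_Lp_norm_tendsto_0[OF p]])
    show "\<exists>Cp>0. (\<alpha> > ?d - 1 \<longrightarrow> Cp = K p * sqrt C) \<and>
             (\<forall>\<kappa>\<ge>l0. Lp_L2_norm p M (\<lambda>\<omega> x. T \<omega> x - truncated_field S a \<kappa> \<omega> x)
                \<le> Cp * real \<kappa> powr (- ((\<alpha> + 1 - ?d) / 2)))"
    proof (cases "?d - 1 < \<alpha>")
      case True
      then show ?thesis
        unfolding error using remainder_Lp_rate[OF assms(1) True C l0 decay p] K_pos[of p] C
        by (intro exI[of _ "K p * sqrt C"]) (auto simp: K_def)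
    next
      case False
      obtain B where B: "0 < B" "\<And>k. Lp_L2_norm p M (remainder k) \<le> B"
        using remainder_Lp_norm_bounded[OF p] by blast
      have "Lp_L2_norm p M (remainder (Suc \<kappa>)) \<le> B * real \<kappa> powr (- ((\<alpha> + 1 - ?d) / 2))" if "l0 \<le> \<kappa>" for \<kappa>
      proof -
        have "1 \<le> real \<kappa> powr (- ((\<alpha> + 1 - ?d) / 2))"
          using that l0 False by (intro ge_one_powr_ge_zero) auto
        then have "B * 1 \<le> B * real \<kappa> powr (- ((\<alpha> + 1 - ?d) / 2))"
          using B(1) by (intro mult_left_mono) auto
        then show ?thesis using B(2)[of "Suc \<kappa>"] by simp
      qed
      then show ?thesis unfolding error using B(1) False by (intro exI[of _ B]) auto
    qed
  qed
qed

end
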